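(* Let $M$ be an arbitrary $d\times d$ matrix dilation, $c\in\frac12\mathbb Z^d$ and $n\in\mathbb N$. A general form for all masks $m_0$ which are symmetric with respect to the point $c$ in the sense (a), i.e. $m_0(\xi)=e^{2\pi i(2c,\xi)}m_0(-\xi)$, and have sum rule of order $n$ (with respect to $M$) is given by $$m_0(\xi)=m_0^*(\xi)+e^{2\pi i(c,\xi)}\sum_{j\in J}\ \sum_{\alpha\in\mathbb Z^d_+,\,[\alpha]=n}\Big(A_{\alpha j}(M^*\xi)\,\mathrm{Re}\,\Pi_\alpha(M^*\xi)+i\,B_{\alpha j}(M^*\xi)\,\mathrm{Im}\,\Pi_\alpha(M^*\xi)\Big)$$ $$+\sum_{i\in I^1}\ \sum_{\alpha\in\mathbb Z^d_+,\,[\alpha]=n}\Big(T_{\alpha i}(M^*\xi)\Pi_\alpha(M^*\xi)e^{2\pi i(s_i,\xi)}+T_{\alpha i}(-M^*\xi)\Pi_\alpha(-M^*\xi)e^{2\pi i(2c-s_i,\xi)}\Big),$$ where, for $\alpha\in\mathbb Z^d_+$, $[\alpha]=n$, $j\in J$, $i\in I^1$: $A_{\alpha j}$ and $B_{\alpha j}$ are arbitrary respectively even and odd trigonometric polynomials of semi-integer degrees associated with $\sigma=M^{-1}(c-s_j)-\lfloor M^{-1}(c-s_j)\rfloor$; $T_{\alpha i}$ are arbitrary trigonometric polynomials; and $m_0^*$ is the mask $$m_0^*(\xi)=\frac1m\sum_{j\in J}\sum_{\beta\in\Delta_n}\lambda'_\beta G^A_{\beta j}(M^*\xi)e^{2\pi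 i(c,\xi)}$$ $$+\frac1m\sum_{i\in I^1}\sum_{\beta\in\Delta_n}\ \sum_{\gamma\in\mathbb Z^d_+,\,\gamma\le\beta}\lambda'_\gamma\binom{\beta}{\gamma}(M^{-1}(c-s_i))^{\beta-\gamma}\Big(G_{\beta i}(M^*\xi)e^{2\pi i(s_i,\xi)}+G_{\beta i}(-M^*\xi)e^{2\pi i(2c-s_i,\xi)}\Big)$$ for some parameters $\lambda'_\alpha\in\mathbb C$, $\alpha\in\Delta_n$, with $\lambda'_{\mathbf 0}=1$ and $\lambda'_\alpha=0$ if $[\alpha]$ is odd. (That is, a trigonometric polynomial is a mask with the two stated properties if and only if it can be written in this form.)
   Context: Notation: $\mathbb Z^d_+=\{x\in\mathbb Z^d:x\ge\mathbf 0\}$, inequalities and floor $\lfloor\cdot\rfloor$ of vectors are coordinatewise; $[\alpha]=\sum_j\alpha_j$; $\binom{\beta}{\gamma}=\beta!/(\gamma!(\beta-\gamma)!)$ and $a^b=\prod_j a_j^{b_j}$ for multi-indices; $\Delta_n=\{\alpha\in\mathbb Z^d_+:[\alpha]<n\}$, $\Delta_n^e=\{\alpha\in\Delta_n:[\alpha]\text{ even}\}$; $\Pi_\alpha(\xi)=\prod_{j=1}^d(1-e^{2\pi i\xi_j})^{\alpha_j}$. A matrix dilation $M$ is an integer $d\times d$ matrix all of whose eigenvalues are bigger than 1 in modulus; $M^*$ is its conjugate (transpose), $m=|\det M|$. A set of digits $D(M)=\{s_0,\dots,s_{m-1}\}$ contains exactly one representative of each of the $m$ cosets of $\mathbb Z^d/M\mathbb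 Z^d$. A trigonometric polynomial of semi-integer degrees associated with $\sigma\in\frac12\mathbb Z^d\cap[0,\frac12]^d$ is a finite sum $\sum_{k\in\mathbb Z^d}h_ke^{2\pi i(k+\sigma,\xi)}$, $h_k\in\mathbb C$; a trigonometric polynomial is the case $\sigma=\mathbf 0$. A mask is a trigonometric polynomial $m_0$ with $m_0(\mathbf 0)=1$. A trigonometric polynomial $t$ has sum rule of order $n$ with respect to $M$ if $D^\beta\big(t(M^{*-1}\xi)\big)|_{\xi=s}=0$ for all $s\in D(M^* )\setminus\{\mathbf 0\}$ and all $\beta\in\Delta_n$, where $D(M^* )$ is a set of digits of $M^*$ containing $\mathbf 0$. Index sets: for each $k\in\{0,\dots,m-1\}$ there is a unique $l\in\{0,\dots,m-1\}$ with $M^{-1}(2c-s_k-s_l)\in\mathbb Z^d$. $J$ is the set of those $k$ for which $l=k$; $I$ is the set of those $k$ for which $l\ne k$, and for $i\in I$ the corresponding $l$ is denoted $i'$ (also in $I$). The digits are chosen so that $s_i+s_{i'}=2c$ for all $i\in I$. $I=I^1\cup I^2$ is a disjoint splitting such that $i\in I^1$ iff $i'\in I^2$. $\Theta_{\beta,n}$ (for $\beta\in\Delta_n$) is the class of trigonometric polynomials $t$ of integer or semi-integer degrees with $D^\alpha t(\mathbf 0)=(2\pi i)^{[\alpha]}\delta_{\alpha\beta}$ for all $\alpha\in\Delta_n$; $\Theta^A_{\beta,n}=\{t\in\Theta_{\beta,n}:t(\xi)=t(-\xi)\}$ for $\beta\in\Delta_n^e$. In the formula for $m_0^*$, $G_{\beta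 i}\in\Theta_{\beta,n}$ ($\beta\in\Delta_n$, $i\in I^1$) are (chosen) trigonometric polynomials and $G^A_{\beta j}\in\Theta^A_{\beta,n}$ ($\beta\in\Delta_n^e$, $j\in J$) are (chosen) trigonometric polynomials of semi-integer degrees associated with $\sigma=M^{-1}(c-s_j)-\lfloor M^{-1}(c-s_j)\rfloor$; terms with $[\beta]$ odd in the sum over $J$ are absent since $\lambda'_\beta=0$. *)

theory Defs
  imports "HOL-Analysis.Analysis"
begin

section \<open>Multi-indices\<close>

text \<open>Multi-indices are vectors of type \<open>nat ^ 'd\<close>; the order on vectors is coordinatewise.\<close>

definition msize :: "nat ^ 'd \<Rightarrow> nat" where
  "msize \<alpha> = (\<Sum>j\<in>UNIV. \<alpha> $ j)"

definition Delta :: "nat \<Rightarrow> (nat ^ 'd) set" where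
  "Delta n = {\<alpha>. msize \<alpha> < n}"

definition Delta_even :: "nat \<Rightarrow> (nat ^ 'd) set" where
  "Delta_even n = {\<alpha> \<in> Delta n. even (msize \<alpha>)}"

definition mfact :: "nat ^ 'd \<Rightarrow> nat" where
  "mfact \<alpha> = (\<Prod>j\<in>UNIV. fact (\<alpha> $ j))"

definition mbinom :: "nat ^ 'd \<Rightarrow> nat ^ 'd \<Rightarrow> real" where
  "mbinom \<beta> \<gamma> = real (mfact \<beta>) / (real (mfact \<gamma>) * real (mfact (\<beta> - \<gamma>)))"

definition mpower :: "real ^ 'd \<Rightarrow> nat ^ 'd \<Rightarrow> real" where
  "mpower a b = (\<Prod>j\<in>UNIV. (a $ j) ^ (b $ j))"

section \<open>Partial derivatives\<close>

definition partial_deriv :: "'d \<Rightarrow> (real ^ 'd \<Rightarrow> complex) \<Rightarrow> real ^ 'd \<Rightarrow> complex" where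
  "partial_deriv j f x = vector_derivative (\<lambda>t. f (x + t *\<^sub>R axis j 1)) (at 0)"

text \<open>The iterated partial derivative \<open>D\<^sup>\<beta> f\<close>. The coordinates are taken in an arbitrary
  fixed order; \<open>mderiv\<close> is only used for smooth functions, where the order is irrelevant.\<close>

definition mderiv :: "nat ^ 'd::finite \<Rightarrow> (real ^ 'd \<Rightarrow> complex) \<Rightarrow> real ^ 'd \<Rightarrow> complex" where
  "mderiv \<beta> f =
     fold (\<lambda>j. partial_deriv j ^^ (\<beta> $ j)) (SOME js. distinct js \<and> set js = UNIV) f"

section \<open>Matrix dilations and digits\<close>

definition of_int_vec :: "int ^ 'd \<Rightarrow> real ^ 'd" where
  "of_int_vec k = (\<chi> j. of_int (k $ j))"

definition int_lattice :: "(real ^ 'd) set" where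
  "int_lattice = range of_int_vec"

definition half_lattice :: "(real ^ 'd) set" where
  "half_lattice = {x. 2 *\<^sub>R x \<in> int_lattice}"

definition matrix_dilation :: "int ^ 'd ^ 'd::finite \<Rightarrow> bool" where
  "matrix_dilation M \<longleftrightarrow>
     (\<forall>(z::complex) v. v \<noteq> 0 \<and> map_matrix of_int M *v v = z *s v \<longrightarrow> norm z > 1)"

definition mapply :: "int ^ 'd ^ 'd::finite \<Rightarrow> real ^ 'd \<Rightarrow> real ^ 'd" where
  "mapply M x = map_matrix of_int M *v x"

definition mapply_inv :: "int ^ 'd ^ 'd::finite \<Rightarrow> real ^ 'd \<Rightarrow> real ^ 'd" where
  "mapply_inv M x = matrix_inv (map_matrix of_int M) *v x"

definition index_det :: "int ^ 'd ^ 'd::finite \<Rightarrow> nat" where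
  "index_det M = nat \<bar>det M\<bar>"

definition digit_set :: "int ^ 'd ^ 'd::finite \<Rightarrow> (int ^ 'd) set \<Rightarrow> bool" where
  "digit_set M D \<longleftrightarrow> (\<forall>x. \<exists>!s. s \<in> D \<and> (\<exists>y. x - s = M *v y))"

definition digit_enum :: "int ^ 'd ^ 'd::finite \<Rightarrow> (nat \<Rightarrow> int ^ 'd) \<Rightarrow> bool" where
  "digit_enum M s \<longleftrightarrow>
     inj_on s {..<index_det M} \<and> digit_set M (s ` {..<index_det M})"

section \<open>Trigonometric polynomials and masks\<close>

definition wave :: "real ^ 'd \<Rightarrow> real ^ 'd \<Rightarrow> complex" where
  "wave a \<xi> = exp (2 * complex_of_real pi * \<i> * complex_of_real (a \<bullet> \<xi>))"

definition semi_trig_poly :: "real ^ 'd \<Rightarrow> (real ^ 'd \<Rightarrow> complex) \<Rightarrow> bool" where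
  "semi_trig_poly \<sigma> t \<longleftrightarrow>
     \<sigma> \<in> half_lattice \<and> (\<forall>j. 0 \<le> \<sigma> $ j \<and> \<sigma> $ j \<le> 1/2) \<and>
     (\<exists>h :: int ^ 'd \<Rightarrow> complex. finite {k. h k \<noteq> 0} \<and>
        t = (\<lambda>\<xi>. \<Sum>k | h k \<noteq> 0. h k * wave (of_int_vec k + \<sigma>) \<xi>))"

definition trig_poly :: "(real ^ 'd \<Rightarrow> complex) \<Rightarrow> bool" where
  "trig_poly t \<longleftrightarrow> semi_trig_poly 0 t"

definition mask :: "(real ^ 'd \<Rightarrow> complex) \<Rightarrow> bool" where
  "mask m0 \<longleftrightarrow> trig_poly m0 \<and> m0 0 = 1"

definition symmetric_about :: "real ^ 'd \<Rightarrow> (real ^ 'd \<Rightarrow> complex) \<Rightarrow> bool" where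
  "symmetric_about c t \<longleftrightarrow> (\<forall>\<xi>. t \<xi> = wave (2 *\<^sub>R c) \<xi> * t (- \<xi>))"

text \<open>Here \<open>D\<close> stands for a set of digits of the transposed matrix that contains \<open>0\<close>.\<close>

definition sum_rule ::
  "int ^ 'd ^ 'd::finite \<Rightarrow> (int ^ 'd) set \<Rightarrow> nat \<Rightarrow> (real ^ 'd \<Rightarrow> complex) \<Rightarrow> bool" where
  "sum_rule M D n t \<longleftrightarrow>
     (\<forall>s \<in> D - {0}. \<forall>\<beta> \<in> Delta n.
        mderiv \<beta> (\<lambda>\<xi>. t (mapply_inv (transpose M) \<xi>)) (of_int_vec s) = 0)"

definition Pi_poly :: "nat ^ 'd \<Rightarrow> real ^ 'd \<Rightarrow> complex" where
  "Pi_poly \<alpha> \<xi> =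
     (\<Prod>j\<in>UNIV. (1 - exp (2 * complex_of_real pi * \<i> * complex_of_real (\<xi> $ j))) ^ (\<alpha> $ j))"

definition Theta :: "nat ^ 'd::finite \<Rightarrow> nat \<Rightarrow> (real ^ 'd \<Rightarrow> complex) set" where
  "Theta \<beta> n =
     {t. (\<exists>\<sigma>. semi_trig_poly \<sigma> t) \<and>
         (\<forall>\<alpha> \<in> Delta n. mderiv \<alpha> t 0 =
            (2 * complex_of_real pi * \<i>) ^ msize \<alpha> * (if \<alpha> = \<beta> then 1 else 0))}"

definition Theta_A :: "nat ^ 'd::finite \<Rightarrow> nat \<Rightarrow> (real ^ 'd \<Rightarrow> complex) set" where
  "Theta_A \<beta> n = {t \<in> Theta \<beta> n. \<forall>\<xi>. t \<xi> = t (- \<xi>)}"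

section \<open>Index sets of digits\<close>

text \<open>Since \<open>2c\<close> is an integer vector and the digits represent each coset modulo \<open>M\<close> exactly
  once, the description in \<open>partner\<close> determines a unique index.\<close>

definition partner ::
  "int ^ 'd ^ 'd::finite \<Rightarrow> real ^ 'd \<Rightarrow> (nat \<Rightarrow> int ^ 'd) \<Rightarrow> nat \<Rightarrow> nat" where
  "partner M c s k =
     (THE l. l < index_det M \<and>
        mapply_inv M (2 *\<^sub>R c - of_int_vec (s k) - of_int_vec (s l)) \<in> int_lattice)"

definition J_set ::
  "int ^ 'd ^ 'd::finite \<Rightarrow> real ^ 'd \<Rightarrow> (nat \<Rightarrow> int ^ 'd) \<Rightarrow> nat set" where
  "J_set M c s = {k. k < index_det M \<and> partner M c s k = k}"

definition I_set ::
  "int ^ 'd ^ 'd::finite \<Rightarrow> real ^ 'd \<Rightarrow> (nat \<Rightarrow> int ^ 'd) \<Rightarrow> nat set" where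
  "I_set M c s = {k. k < index_det M \<and> partner M c s k \<noteq> k}"

definition digit_shift ::
  "int ^ 'd ^ 'd::finite \<Rightarrow> real ^ 'd \<Rightarrow> (nat \<Rightarrow> int ^ 'd) \<Rightarrow> nat \<Rightarrow> real ^ 'd" where
  "digit_shift M c s k = mapply_inv M (c - of_int_vec (s k))"

definition sigma_of ::
  "int ^ 'd ^ 'd::finite \<Rightarrow> real ^ 'd \<Rightarrow> (nat \<Rightarrow> int ^ 'd) \<Rightarrow> nat \<Rightarrow> real ^ 'd" where
  "sigma_of M c s k = (\<chi> r. frac (digit_shift M c s k $ r))"

section \<open>The particular mask\<close>

text \<open>For odd \<open>msize \<beta>\<close> no assumption is made on \<open>GA \<beta> j\<close>; these terms vanish because
  \<open>lam \<beta> = 0\<close> there.\<close>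

definition m0_star ::
  "int ^ 'd ^ 'd::finite \<Rightarrow> real ^ 'd \<Rightarrow> nat \<Rightarrow> (nat \<Rightarrow> int ^ 'd) \<Rightarrow> nat set \<Rightarrow>
   (nat ^ 'd \<Rightarrow> nat \<Rightarrow> real ^ 'd \<Rightarrow> complex) \<Rightarrow> (nat ^ 'd \<Rightarrow> nat \<Rightarrow> real ^ 'd \<Rightarrow> complex) \<Rightarrow>
   (nat ^ 'd \<Rightarrow> complex) \<Rightarrow> real ^ 'd \<Rightarrow> complex" where
  "m0_star M c n s I1 G GA lam \<xi> =
     1 / of_nat (index_det M) *
       (\<Sum>j \<in> J_set M c s. \<Sum>\<beta> \<in> Delta n.
          lam \<beta> * GA \<beta> j (mapply (transpose M) \<xi>) * wave c \<xi>) +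
     1 / of_nat (index_det M) *
       (\<Sum>i \<in> I1. \<Sum>\<beta> \<in> Delta n. \<Sum>\<gamma> \<in> {\<gamma>. \<gamma> \<le> \<beta>}.
          lam \<gamma> * complex_of_real (mbinom \<beta> \<gamma>) *
          complex_of_real (mpower (digit_shift M c s i) (\<beta> - \<gamma>)) *
          (G \<beta> i (mapply (transpose M) \<xi>) * wave (of_int_vec (s i)) \<xi> +
           G \<beta> i (- mapply (transpose M) \<xi>) * wave (2 *\<^sub>R c - of_int_vec (s i)) \<xi>))"

end

theory Submission
  imports Defs
begin

text \<open>
Everything takes place among finite sums of waves \<open>wave a\<close> whose frequencies \<open>a\<close> may be
arbitrary real vectors. The derivative \<open>D\<^sup>\<beta>\<close> of such a sum at the origin is
\<open>(2\<pi>i)\<^bsup>[\<beta>]\<^esup>\<close> times the moment \<open>\<Sum> h\<^sub>a a\<^sup>\<beta>\<close> of its coefficients, so every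
condition on derivatives is a linear condition on moments.

In the variable \<open>\<eta> = M\<^sup>* \<xi>\<close>, sorting the frequencies of a trigonometric polynomial by cosets
of \<open>M \<int>\<^sup>d\<close> gives \<open>m\<^sub>0 \<xi> = wave c \<xi> * (\<Sum>k<m. q\<^sub>k (M\<^sup>* \<xi>))\<close>, where the frequencies of \<open>q\<^sub>k\<close>
are congruent to \<open>- M\<^sup>-\<^sup>1 (c - s\<^sub>k)\<close> modulo \<open>\<int>\<^sup>d\<close>. In these components the three requirements
decouple (\<open>mask_iff_polyphase\<close>):
  \<^item> The symmetry exchanges the components with the indices \<open>k\<close> and \<open>k'\<close>, up to the reflection
    \<open>\<eta> \<mapsto> - \<eta>\<close>.
  \<^item> Translating \<open>\<eta>\<close> by a dual digit \<open>x\<close> multiplies the component \<open>k\<close> of \<open>m\<^sub>0\<close> by the root of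
    unity \<open>wave (M\<^sup>-\<^sup>1 s\<^sub>k) x\<close>. Orthogonality of the characters of \<open>\<int>\<^sup>d / M\<^sup>* \<int>\<^sup>d\<close> turns the sum rule
    into the statement that all \<open>q\<^sub>k\<close> have the same moments of order less than \<open>n\<close>; the common
    values are the numbers \<open>\<lambda>'\<^sub>\<beta> / m\<close>.
  \<^item> The normalisation \<open>m\<^sub>0 0 = 1\<close> is \<open>\<lambda>'\<^sub>0 = 1\<close>, and the odd \<open>\<lambda>'\<^sub>\<beta>\<close> vanish because the family of
    components is invariant under reflection.

It remains to solve for a single component with prescribed moments. The chosen polynomials
\<open>G\<close> and \<open>G\<^sup>A\<close> provide one solution, and two solutions differ by a sum all of whose moments of
order less than \<open>n\<close> vanish. After multiplication by a wave such a sum has integer frequencies,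
hence is a Laurent polynomial in \<open>z\<^sub>j = exp (2\<pi>i\<xi>\<^sub>j)\<close> vanishing to order \<open>n\<close> at \<open>z = (1, ..., 1)\<close>,
and it lies in the ideal generated by the products \<open>Pi_poly \<alpha>\<close> with \<open>[\<alpha>] = n\<close>
(\<open>flat_imp_Pi_span\<close>). If \<open>k \<noteq> k'\<close>, one of the two components is free, and this is all
(\<open>free_component_iff\<close>). If \<open>k = k'\<close>, the component is even, and averaging a combination of the
\<open>Pi_poly \<alpha>\<close> with its reflection produces their real and imaginary parts with even and odd
coefficients (\<open>self_paired_component_iff\<close>).
\<close>

section \<open>Lattice vectors and waves\<close>

lemma of_int_vec_nth [simp]: "of_int_vec k $ j = of_int (k $ j)"
  by (simp add: of_int_vec_def)

lemma of_int_vec_add: "of_int_vec (k + l) = of_int_vec k + of_int_vec l"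
  by (simp add: vec_eq_iff)

lemma of_int_vec_diff: "of_int_vec (k - l) = of_int_vec k - of_int_vec l"
  by (simp add: vec_eq_iff)

lemma of_int_vec_0 [simp]: "of_int_vec 0 = 0"
  by (simp add: vec_eq_iff)

lemma of_int_vec_inject [simp]: "of_int_vec k = of_int_vec l \<longleftrightarrow> k = l"
  by (simp add: vec_eq_iff)

lemma of_int_vec_axis: "of_int_vec (axis j 1) = axis j 1"
  by (simp add: vec_eq_iff axis_def)

lemma int_lattice_iff: "x \<in> int_lattice \<longleftrightarrow> (\<forall>j. x $ j \<in> \<int>)"
proof
  assume "\<forall>j. x $ j \<in> \<int>"
  then have "x = of_int_vec (\<chi> j. \<lfloor>x $ j\<rfloor>)"
    by (simp add: vec_eq_iff of_int_floor)
  then show "x \<in> int_lattice"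
    unfolding int_lattice_def by blast
qed (auto simp: int_lattice_def)

lemma int_lattice_of_int [simp]: "of_int_vec k \<in> int_lattice"
  by (simp add: int_lattice_def)

lemma int_lattice_0 [simp]: "0 \<in> int_lattice"
  by (simp add: int_lattice_iff)

lemma int_lattice_add: "x \<in> int_lattice \<Longrightarrow> y \<in> int_lattice \<Longrightarrow> x + y \<in> int_lattice"
  by (simp add: int_lattice_iff)

lemma int_lattice_diff: "x \<in> int_lattice \<Longrightarrow> y \<in> int_lattice \<Longrightarrow> x - y \<in> int_lattice"
  by (simp add: int_lattice_iff)

lemma int_lattice_uminus: "- x \<in> int_lattice \<longleftrightarrow> x \<in> int_lattice"
  by (simp add: int_lattice_iff)

lemma wave_0 [simp]: "wave 0 \<xi> = 1" "wave a 0 = 1"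
  by (simp_all add: wave_def)

lemma wave_add: "wave (a + b) \<xi> = wave a \<xi> * wave b \<xi>"
  by (simp add: wave_def inner_add_left exp_add [symmetric] algebra_simps)

lemma wave_add_right: "wave a (\<xi> + \<eta>) = wave a \<xi> * wave a \<eta>"
  by (simp add: wave_def inner_add_right exp_add [symmetric] algebra_simps)

lemma wave_uminus: "wave (- a) \<xi> = wave a (- \<xi>)"
  by (simp add: wave_def)

lemma wave_diff: "wave (a - b) \<xi> = wave a \<xi> * wave b (- \<xi>)"
  using wave_add[of a "- b" \<xi>] by (simp add: wave_uminus)

lemma wave_mult_cancel [simp]: "wave a \<xi> * wave a (- \<xi>) = 1" "wave a (- \<xi>) * wave a \<xi> = 1"
  using wave_add_right[of a \<xi> "- \<xi>"] by (simp_all add: mult.commute)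

lemma wave_mult_cancel_left [simp]:
  "wave a \<xi> * (wave a (- \<xi>) * z) = z" "wave a (- \<xi>) * (wave a \<xi> * z) = z"
  by (simp_all add: mult.assoc [symmetric])

lemma wave_nonzero [simp]: "wave a \<xi> \<noteq> 0"
  by (simp add: wave_def)

lemma cnj_wave: "cnj (wave a \<xi>) = wave a (- \<xi>)"
  by (simp add: wave_def exp_cnj)

lemma wave_eq_1: "a \<bullet> \<xi> \<in> \<int> \<Longrightarrow> wave a \<xi> = 1"
  by (auto simp: wave_def exp_eq_1 elim!: Ints_cases)

lemma wave_eq_1_iff: "wave a \<xi> = 1 \<longleftrightarrow> a \<bullet> \<xi> \<in> \<int>"
proof
  assume "wave a \<xi> = 1"
  then obtain k :: int where "a \<bullet> \<xi> = of_int k"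
    by (auto simp: wave_def exp_eq_1)
  then show "a \<bullet> \<xi> \<in> \<int>" by simp
qed (rule wave_eq_1)

lemma wave_int_int: "a \<in> int_lattice \<Longrightarrow> x \<in> int_lattice \<Longrightarrow> wave a x = 1"
  by (rule wave_eq_1) (auto simp: int_lattice_iff inner_vec_def intro!: Ints_sum Ints_mult)

section \<open>Exponential sums\<close>

text \<open>
Real frequencies are needed because substituting \<open>M\<^sup>*\<^sup>-\<^sup>1 \<xi>\<close> leaves the integer lattice. Generating
the sums wave by wave makes every closure property an induction.
\<close>

inductive exp_poly :: "(real ^ 'd) set \<Rightarrow> (real ^ 'd \<Rightarrow> complex) \<Rightarrow> bool" for L where
  exp_poly_0 [intro, simp]: "exp_poly L (\<lambda>\<xi>. 0)"
| exp_poly_step: "a \<in> L \<Longrightarrow> exp_poly L f \<Longrightarrow> exp_poly L (\<lambda>\<xi>. z * wave a \<xi> + f \<xi>)"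

lemma exp_poly_mono: "exp_poly L f \<Longrightarrow> L \<subseteq> L' \<Longrightarrow> exp_poly L' f"
  by (induction rule: exp_poly.induct) (auto intro: exp_poly.intros)

lemma exp_poly_UNIV: "exp_poly L f \<Longrightarrow> exp_poly UNIV f"
  by (erule exp_poly_mono) simp

lemma exp_poly_wave: "a \<in> L \<Longrightarrow> exp_poly L (wave a)"
  using exp_poly_step[of a L "\<lambda>_. 0" 1] by simp

lemma exp_poly_add: "exp_poly L f \<Longrightarrow> exp_poly L g \<Longrightarrow> exp_poly L (\<lambda>\<xi>. f \<xi> + g \<xi>)"
  by (induction rule: exp_poly.induct) (auto intro: exp_poly.intros simp: add.assoc)

lemma exp_poly_scale: "exp_poly L f \<Longrightarrow> exp_poly L (\<lambda>\<xi>. z * f \<xi>)"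
  by (induction rule: exp_poly.induct)
    (auto intro: exp_poly.intros simp: ring_distribs mult.assoc [symmetric])

lemma exp_poly_diff: "exp_poly L f \<Longrightarrow> exp_poly L g \<Longrightarrow> exp_poly L (\<lambda>\<xi>. f \<xi> - g \<xi>)"
  using exp_poly_add[of L f "\<lambda>\<xi>. - 1 * g \<xi>"] exp_poly_scale[of L g "- 1"] by simp

lemma exp_poly_sum:
  "(\<And>i. i \<in> A \<Longrightarrow> exp_poly L (f i)) \<Longrightarrow> exp_poly L (\<lambda>\<xi>. \<Sum>i\<in>A. f i \<xi>)"
  by (induction A rule: infinite_finite_induct) (auto intro: exp_poly_add)

lemma exp_poly_wave_times:
  assumes "exp_poly L f" "\<And>a. a \<in> L \<Longrightarrow> b + a \<in> L'"
  shows "exp_poly L' (\<lambda>\<xi>. wave b \<xi> * f \<xi>)"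
  using assms
proof (induction rule: exp_poly.induct)
  case (exp_poly_step a f z)
  have "exp_poly L' (\<lambda>\<xi>. z * wave (b + a) \<xi> + wave b \<xi> * f \<xi>)"
    by (intro exp_poly.intros exp_poly_step)
  then show ?case by (simp add: wave_add algebra_simps)
qed simp

lemma exp_poly_mult:
  assumes "exp_poly L f" "exp_poly L' g" "\<And>a b. a \<in> L \<Longrightarrow> b \<in> L' \<Longrightarrow> a + b \<in> L''"
  shows "exp_poly L'' (\<lambda>\<xi>. f \<xi> * g \<xi>)"
  using assms
proof (induction rule: exp_poly.induct)
  case (exp_poly_step a f z)
  have "exp_poly L'' (\<lambda>\<xi>. z * (wave a \<xi> * g \<xi>) + f \<xi> * g \<xi>)"
    by (intro exp_poly_add exp_poly_scale exp_poly_step.IH exp_poly_wave_times[OF exp_poly_step.prems(1)])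
      (use exp_poly_step in auto)
  then show ?case by (simp add: algebra_simps)
qed simp

lemma exp_poly_reflect:
  assumes "exp_poly L f" "\<And>a. a \<in> L \<Longrightarrow> - a \<in> L'"
  shows "exp_poly L' (\<lambda>\<xi>. f (- \<xi>))"
  using assms
proof (induction rule: exp_poly.induct)
  case (exp_poly_step a f z)
  then have "exp_poly L' (\<lambda>\<xi>. z * wave (- a) \<xi> + f (- \<xi>))"
    by (intro exp_poly.intros) auto
  then show ?case by (simp add: wave_uminus)
qed simp

lemma exp_poly_const: "0 \<in> L \<Longrightarrow> exp_poly L (\<lambda>\<xi>. z)"
  using exp_poly_scale[OF exp_poly_wave, of 0 L z] by simp

lemma exp_poly_prod:
  assumes "\<And>i. i \<in> A \<Longrightarrow> exp_poly int_lattice (f i)"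
  shows "exp_poly int_lattice (\<lambda>\<xi>. \<Prod>i\<in>A. f i \<xi>)"
  using assms
proof (induction A rule: infinite_finite_induct)
  case (insert i A)
  then show ?case
    by (auto intro!: exp_poly_mult[of int_lattice _ int_lattice] int_lattice_add)
qed (simp_all add: exp_poly_const)

lemma exp_poly_power:
  "exp_poly int_lattice f \<Longrightarrow> exp_poly int_lattice (\<lambda>\<xi>. f \<xi> ^ k)"
  by (induction k) (auto intro: exp_poly_const exp_poly_mult int_lattice_add)

text \<open>
Derivatives are computed on explicit sums, because iterated partial derivatives act on a finite
set of waves simultaneously by rescaling the coefficients.
\<close>

lemma exp_poly_as_sum:
  assumes "exp_poly L f"
  obtains F h where "finite F" "F \<subseteq> L" "f = (\<lambda>\<xi>. \<Sum>a\<in>F. h a * wave a \<xi>)"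
  using assms
proof (induction arbitrary: thesis rule: exp_poly.induct)
  case exp_poly_0
  show ?case by (rule exp_poly_0[of "{}"]) auto
next
  case (exp_poly_step a f z)
  obtain F h where F: "finite F" "F \<subseteq> L" and f: "f = (\<lambda>\<xi>. \<Sum>a\<in>F. h a * wave a \<xi>)"
    using exp_poly_step.IH by blast
  define h' where "h' b = (if b \<in> F then h b else 0) + (if b = a then z else 0)" for b
  have "(\<Sum>b\<in>insert a F. h' b * wave b \<xi>) = z * wave a \<xi> + f \<xi>" for \<xi>
  proof -
    have "(\<Sum>b\<in>insert a F. h' b * wave b \<xi>)
        = (\<Sum>b\<in>insert a F. (if b \<in> F then h b else 0) * wave b \<xi>)
          + (\<Sum>b\<in>insert a F. (if b = a then z * wave b \<xi> else 0))"
      by (subst sum.distrib [symmetric], rule sum.cong) (auto simp: h'_def algebra_simps)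
    also have "(\<Sum>b\<in>insert a F. (if b \<in> F then h b else 0) * wave b \<xi>)
        = (\<Sum>b\<in>F. h b * wave b \<xi>)"
      by (rule sum.mono_neutral_cong_right) (use F in auto)
    finally show ?thesis using F by (simp add: f)
  qed
  then show ?case
    by (intro exp_poly_step.prems[of "insert a F" h']) (use F exp_poly_step in auto)
qed

lemma exp_poly_semi_trig_poly:
  fixes \<sigma> :: "real ^ 'd"
  shows
  "semi_trig_poly \<sigma> t \<longleftrightarrow>
     \<sigma> \<in> half_lattice \<and> (\<forall>j. 0 \<le> \<sigma> $ j \<and> \<sigma> $ j \<le> 1/2) \<and> exp_poly ((+) \<sigma> ` int_lattice) t"
proof -
  have "(\<exists>h :: int ^ 'd \<Rightarrow> complex. finite {k. h k \<noteq> 0} \<and>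
        t = (\<lambda>\<xi>. \<Sum>k | h k \<noteq> 0. h k * wave (of_int_vec k + \<sigma>) \<xi>))
      \<longleftrightarrow> exp_poly ((+) \<sigma> ` int_lattice) t" (is "?A \<longleftrightarrow> ?B")
  proof
    assume ?A
    then show ?B
      by (auto intro!: exp_poly_sum exp_poly_scale exp_poly_wave simp: add.commute)
  next
    assume ?B
    then obtain F h where F: "finite F" "F \<subseteq> (+) \<sigma> ` int_lattice"
      and t: "t = (\<lambda>\<xi>. \<Sum>a\<in>F. h a * wave a \<xi>)" by (rule exp_poly_as_sum)
    define v where "v k = of_int_vec k + \<sigma>" for k :: "int ^ 'd"
    have inj: "inj v" by (auto simp: inj_on_def v_def)
    define g where "g k = (if v k \<in> F then h (v k) else 0)" for k
    have range: "F \<subseteq> range v" using F(2) by (auto simp: v_def int_lattice_def add.commute)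
    have fin: "finite (v -` F)" using F(1) inj by (simp add: finite_vimageI)
    have sub: "{k. g k \<noteq> 0} \<subseteq> v -` F" by (auto simp: g_def)
    \<comment> \<open>The frequencies with a zero coefficient in \<open>F\<close> drop out of the support of \<open>g\<close>.\<close>
    have "t \<xi> = (\<Sum>k | g k \<noteq> 0. g k * wave (v k) \<xi>)" for \<xi>
    proof -
      have "(\<Sum>k | g k \<noteq> 0. g k * wave (v k) \<xi>) = (\<Sum>k\<in>v -` F. h (v k) * wave (v k) \<xi>)"
        by (rule sum.mono_neutral_cong_left) (use fin in \<open>auto simp: g_def\<close>)
      also have "\<dots> = (\<Sum>a\<in>v ` (v -` F). h a * wave a \<xi>)"
        using inj by (subst sum.reindex) (auto intro: inj_on_subset)
      also have "v ` (v -` F) = F" using range by auto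
      finally show ?thesis by (simp add: t)
    qed
    then show ?A
      using finite_subset[OF sub fin] by (intro exI[of _ g]) (auto simp: v_def)
  qed
  then show ?thesis unfolding semi_trig_poly_def by blast
qed

lemma exp_poly_trig_poly:
  fixes t :: "real ^ 'd \<Rightarrow> complex"
  shows "trig_poly t \<longleftrightarrow> exp_poly int_lattice t"
proof -
  have "(0::real^'d) \<in> half_lattice" by (simp add: half_lattice_def)
  then show ?thesis unfolding trig_poly_def exp_poly_semi_trig_poly by simp
qed

section \<open>Derivatives of exponential sums\<close>

lemma mpower_0 [simp]: "mpower a 0 = 1"
  by (simp add: mpower_def)

lemma has_vector_derivative_wave:
  "((\<lambda>t. wave a (x + t *\<^sub>R axis j 1)) has_vector_derivative
     (2 * complex_of_real pi * \<i> * of_real (a $ j)) * wave a x) (at 0)"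
proof -
  have "((\<lambda>z. exp (2 * complex_of_real pi * \<i> * (of_real (a \<bullet> x) + z * of_real (a $ j))))
     has_field_derivative (2 * complex_of_real pi * \<i> * of_real (a $ j)) * wave a x)
     (at (of_real 0))"
    by (auto intro!: derivative_eq_intros simp: wave_def)
  from has_vector_derivative_real_field[OF this] show ?thesis
    by (simp add: wave_def inner_add_right inner_axis)
qed

lemma partial_deriv_exp_sum:
  "partial_deriv j (\<lambda>\<xi>. \<Sum>a\<in>F. h a * wave a \<xi>)
     = (\<lambda>\<xi>. \<Sum>a\<in>F. (h a * (2 * complex_of_real pi * \<i> * of_real (a $ j))) * wave a \<xi>)"
  unfolding partial_deriv_def
proof (rule ext, rule vector_derivative_at)
  fix x
  have "((\<lambda>t. \<Sum>a\<in>F. h a * wave a (x + t *\<^sub>R axis j 1)) has_vector_derivative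
     (\<Sum>a\<in>F. h a * ((2 * complex_of_real pi * \<i> * of_real (a $ j)) * wave a x))) (at 0)"
    by (intro has_vector_derivative_sum has_vector_derivative_mult_right has_vector_derivative_wave)
  then show "((\<lambda>t. \<Sum>a\<in>F. h a * wave a (x + t *\<^sub>R axis j 1)) has_vector_derivative
     (\<Sum>a\<in>F. (h a * (2 * complex_of_real pi * \<i> * of_real (a $ j))) * wave a x)) (at 0)"
    by (simp add: mult.assoc)
qed

lemma partial_deriv_pow_exp_sum:
  "(partial_deriv j ^^ k) (\<lambda>\<xi>. \<Sum>a\<in>F. h a * wave a \<xi>)
     = (\<lambda>\<xi>. \<Sum>a\<in>F. (h a * (2 * complex_of_real pi * \<i> * of_real (a $ j)) ^ k) * wave a \<xi>)"
proof (induction k arbitrary: h)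
  case (Suc k)
  show ?case
    unfolding funpow_Suc_right o_apply partial_deriv_exp_sum Suc
    by (simp only: power_Suc mult.assoc)
qed simp

text \<open>
A wave is a common eigenfunction of all partial derivatives, so the order in which \<open>mderiv\<close>
applies them is irrelevant.
\<close>

lemma mderiv_exp_sum:
  fixes F :: "(real ^ 'd::finite) set"
  shows "mderiv \<beta> (\<lambda>\<xi>. \<Sum>a\<in>F. h a * wave a \<xi>)
     = (\<lambda>\<xi>. \<Sum>a\<in>F. (h a * ((2 * complex_of_real pi * \<i>) ^ msize \<beta> * of_real (mpower a \<beta>))) * wave a \<xi>)"
proof -
  have *: "fold (\<lambda>j. partial_deriv j ^^ (\<beta> $ j)) js (\<lambda>\<xi>. \<Sum>a\<in>F. h a * wave a \<xi>)
      = (\<lambda>\<xi>. \<Sum>a\<in>F. (h a * (\<Prod>j\<in>set js. (2 * complex_of_real pi * \<i> * of_real (a $ j)) ^ (\<beta> $ j))) * wave a \<xi>)"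
    if "distinct js" for js using that
  proof (induction js arbitrary: h)
    case (Cons j js)
    then have "j \<notin> set js" "distinct js" by simp_all
    then show ?case
      unfolding fold_Cons o_apply partial_deriv_pow_exp_sum Cons.IH[OF \<open>distinct js\<close>]
      by (simp only: list.set prod.insert finite_set not_False_eq_True mult.assoc)
  qed simp
  define js where "js = (SOME js. distinct js \<and> set js = (UNIV :: 'd set))"
  obtain xs where "set xs = (UNIV :: 'd set)" "distinct xs"
    using finite_distinct_list[of "UNIV :: 'd set"] by auto
  then have js: "distinct js \<and> set js = (UNIV :: 'd set)"
    unfolding js_def by (rule someI[where x = xs, OF conjI, rotated])
  have "(\<Prod>j\<in>UNIV. (w * of_real (a $ j)) ^ (\<beta> $ j)) = w ^ msize \<beta> * of_real (mpower a \<beta>)"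
    for w :: complex and a :: "real ^ 'd"
    by (simp only: power_mult_distrib prod.distrib msize_def mpower_def power_sum
        of_real_prod of_real_power)
  with *[of js] js show ?thesis unfolding mderiv_def js_def [symmetric] by simp
qed

text \<open>Normalised so that the moments of \<open>wave a\<close> are the monomials \<open>a\<^sup>\<beta>\<close>.\<close>

definition moment :: "nat ^ 'd::finite \<Rightarrow> (real ^ 'd \<Rightarrow> complex) \<Rightarrow> complex" where
  "moment \<beta> f = mderiv \<beta> f 0 / (2 * complex_of_real pi * \<i>) ^ msize \<beta>"

lemma moment_exp_sum:
  "moment \<beta> (\<lambda>\<xi>. \<Sum>a\<in>F. h a * wave a \<xi>) = (\<Sum>a\<in>F. h a * of_real (mpower a \<beta>))"
  by (simp add: moment_def mderiv_exp_sum sum_divide_distrib)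

lemma moment_0 [simp]: "moment \<beta> (\<lambda>\<xi>. 0) = 0"
  using moment_exp_sum[of \<beta> _ "{}"] by simp

lemma moment_wave: "moment \<beta> (wave a) = of_real (mpower a \<beta>)"
  using moment_exp_sum[of \<beta> "\<lambda>_. 1" "{a}"] by (simp add: moment_def)

lemma moment_scale:
  assumes "exp_poly L f" shows "moment \<beta> (\<lambda>\<xi>. z * f \<xi>) = z * moment \<beta> f"
proof -
  obtain F h where "finite F" and f: "f = (\<lambda>\<xi>. \<Sum>a\<in>F. h a * wave a \<xi>)"
    using assms by (rule exp_poly_as_sum)
  show ?thesis
    using moment_exp_sum[of \<beta> "\<lambda>a. z * h a" F] moment_exp_sum[of \<beta> h F]
    by (simp add: f sum_distrib_left mult.assoc)
qed

lemma moment_scale_wave: "moment \<beta> (\<lambda>\<xi>. z * wave a \<xi>) = z * of_real (mpower a \<beta>)"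
  by (simp add: moment_scale[OF exp_poly_wave[OF UNIV_I]] moment_wave)

lemma moment_add:
  assumes "exp_poly L f" "exp_poly L' g"
  shows "moment \<beta> (\<lambda>\<xi>. f \<xi> + g \<xi>) = moment \<beta> f + moment \<beta> g"
proof -
  obtain F h where F: "finite F" and f: "f = (\<lambda>\<xi>. \<Sum>a\<in>F. h a * wave a \<xi>)"
    using assms(1) by (rule exp_poly_as_sum)
  obtain G k where G: "finite G" and g: "g = (\<lambda>\<xi>. \<Sum>a\<in>G. k a * wave a \<xi>)"
    using assms(2) by (rule exp_poly_as_sum)
  define h' where "h' a = (if a \<in> F then h a else 0)" for a
  define k' where "k' a = (if a \<in> G then k a else 0)" for a
  have f': "f = (\<lambda>\<xi>. \<Sum>a\<in>F \<union> G. h' a * wave a \<xi>)"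
    unfolding f by (rule ext, rule sum.mono_neutral_cong_left) (use F G in \<open>auto simp: h'_def\<close>)
  have g': "g = (\<lambda>\<xi>. \<Sum>a\<in>F \<union> G. k' a * wave a \<xi>)"
    unfolding g by (rule ext, rule sum.mono_neutral_cong_left) (use F G in \<open>auto simp: k'_def\<close>)
  show ?thesis
    unfolding f' g' sum.distrib [symmetric] distrib_right [symmetric] moment_exp_sum ..
qed

lemma moment_diff:
  assumes "exp_poly L f" "exp_poly L' g"
  shows "moment \<beta> (\<lambda>\<xi>. f \<xi> - g \<xi>) = moment \<beta> f - moment \<beta> g"
  using moment_add[OF assms(1) exp_poly_scale[OF assms(2), of "-1"], of \<beta>]
    moment_scale[OF assms(2), of \<beta> "-1"] by simp

lemma moment_sum:
  assumes "\<And>i. i \<in> A \<Longrightarrow> exp_poly L (f i)"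
  shows "moment \<beta> (\<lambda>\<xi>. \<Sum>i\<in>A. f i \<xi>) = (\<Sum>i\<in>A. moment \<beta> (f i))"
  using assms
proof (induction A rule: infinite_finite_induct)
  case (insert i A)
  then show ?case by (simp add: moment_add[of L _ L] exp_poly_sum)
qed simp_all

lemma mderiv_zero_multiindex: "mderiv 0 f = f"
proof -
  have "fold (\<lambda>j. partial_deriv j ^^ ((0 :: nat ^ 'a) $ j)) js f = f" for js
    by (induction js) simp_all
  then show ?thesis unfolding mderiv_def by blast
qed

lemma moment_zero_multiindex: "moment 0 f = f 0"
  by (simp add: moment_def mderiv_zero_multiindex msize_def)

text \<open>
This moves derivatives at a lattice point to the origin, where they are moments.
\<close>

lemma mderiv_eq_moment_translate:
  assumes "exp_poly L f"
  shows "mderiv \<beta> f x = (2 * complex_of_real pi * \<i>) ^ msize \<beta> * moment \<beta> (\<lambda>\<eta>. f (x + \<eta>))"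
proof -
  obtain F h where f: "f = (\<lambda>\<xi>. \<Sum>a\<in>F. h a * wave a \<xi>)"
    using assms by (rule exp_poly_as_sum)
  have "(\<lambda>\<eta>. f (x + \<eta>)) = (\<lambda>\<eta>. \<Sum>a\<in>F. (h a * wave a x) * wave a \<eta>)"
    by (simp add: f wave_add_right mult.assoc)
  then have "moment \<beta> (\<lambda>\<eta>. f (x + \<eta>)) = (\<Sum>a\<in>F. (h a * wave a x) * of_real (mpower a \<beta>))"
    using moment_exp_sum[of \<beta> "\<lambda>a. h a * wave a x" F] by simp
  then show ?thesis
    by (simp add: f mderiv_exp_sum sum_distrib_left mult.assoc mult.left_commute mult.commute)
qed

text \<open>
Negating the frequency multiplies the monomial \<open>a\<^sup>\<beta>\<close> by \<open>(-1)\<^bsup>[\<beta>]\<^esup>\<close>.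
\<close>

lemma moment_reflect:
  assumes "exp_poly L f"
  shows "moment \<beta> (\<lambda>\<xi>. f (- \<xi>)) = (- 1) ^ msize \<beta> * moment \<beta> f"
  using assms
proof (induction rule: exp_poly.induct)
  case (exp_poly_step a f z)
  have eq: "mpower (- a) \<beta> = (- 1) ^ msize \<beta> * mpower a \<beta>"
    by (simp add: mpower_def msize_def power_minus[of "a $ _"] prod.distrib power_sum)
  have "moment \<beta> (\<lambda>\<xi>. z * wave (- a) \<xi> + f (- \<xi>)) = z * of_real (mpower (- a) \<beta>) + moment \<beta> (\<lambda>\<xi>. f (- \<xi>))"
    by (subst moment_add[where L = UNIV and L' = UNIV])
      (auto intro: exp_poly_scale exp_poly_wave exp_poly_reflect[OF exp_poly_step.hyps(2)]
         simp: moment_scale_wave)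
  moreover have "moment \<beta> (\<lambda>\<xi>. z * wave a \<xi> + f \<xi>) = z * of_real (mpower a \<beta>) + moment \<beta> f"
    by (subst moment_add[where L = UNIV and L' = L])
      (auto intro: exp_poly_scale exp_poly_wave exp_poly_step.hyps(2)
         simp: moment_scale_wave)
  ultimately show ?case
    by (simp add: exp_poly_step.IH eq wave_uminus algebra_simps)
qed simp

section \<open>The multi-binomial theorem\<close>

lemma multiindices_below_eq_image:
  "{\<gamma> :: nat ^ 'd::finite. \<gamma> \<le> \<beta>} = vec_lambda ` (\<Pi>\<^sub>E j\<in>UNIV. {..\<beta> $ j})"
proof (intro equalityI subsetI)
  fix \<gamma> :: "nat ^ 'd" assume "\<gamma> \<in> {\<gamma>. \<gamma> \<le> \<beta>}"
  then have "vec_nth \<gamma> \<in> (\<Pi>\<^sub>E j\<in>UNIV. {..\<beta> $ j})" "\<gamma> = vec_lambda (vec_nth \<gamma>)"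
    by (auto simp: less_eq_vec_def)
  then show "\<gamma> \<in> vec_lambda ` (\<Pi>\<^sub>E j\<in>UNIV. {..\<beta> $ j})" by blast
qed (auto simp: less_eq_vec_def)

lemma finite_multiindices_below [simp]: "finite {\<gamma> :: nat ^ 'd::finite. \<gamma> \<le> \<beta>}"
  unfolding multiindices_below_eq_image by (intro finite_imageI finite_PiE) auto

lemma coord_le_msize: "\<alpha> $ j \<le> msize \<alpha>"
  unfolding msize_def by (rule member_le_sum) auto

lemma finite_msize_le: "finite {\<alpha> :: nat ^ 'd::finite. msize \<alpha> \<le> n}"
proof (rule finite_subset)
  show "{\<alpha>. msize \<alpha> \<le> n} \<subseteq> {\<gamma> :: nat ^ 'd. \<gamma> \<le> (\<chi> j. n)}"
    by (auto simp: less_eq_vec_def intro: order_trans[OF coord_le_msize])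
qed simp

lemma finite_msize_eq [simp]: "finite {\<alpha> :: nat ^ 'd::finite. msize \<alpha> = n}"
  by (rule finite_subset[OF _ finite_msize_le[of n]]) auto

lemma finite_Delta [simp]: "finite (Delta n :: (nat ^ 'd::finite) set)"
  unfolding Delta_def by (rule finite_subset[OF _ finite_msize_le[of n]]) auto

lemma msize_mono: "\<gamma> \<le> \<beta> \<Longrightarrow> msize \<gamma> \<le> msize \<beta>"
  unfolding msize_def by (intro sum_mono) (simp add: less_eq_vec_def)

lemma msize_0 [simp]: "msize 0 = 0"
  by (simp add: msize_def)

lemma msize_eq_0_iff [simp]: "msize \<alpha> = 0 \<longleftrightarrow> \<alpha> = 0"
  by (simp add: msize_def vec_eq_iff)

lemma msize_add: "msize (\<alpha> + \<beta>) = msize \<alpha> + msize \<beta>"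
  by (simp add: msize_def sum.distrib)

lemma msize_axis: "msize (axis j k) = k"
  by (simp add: msize_def axis_def)

text \<open>
The product over the coordinates of the univariate binomial theorem; expanding the product of
sums over \<open>k \<le> \<beta>\<^sub>j\<close> produces one term for each multi-index \<open>\<gamma> \<le> \<beta>\<close>.
\<close>

lemma mpower_add:
  "mpower (a + b) \<beta> = (\<Sum>\<gamma> | \<gamma> \<le> \<beta>. mbinom \<beta> \<gamma> * mpower b (\<beta> - \<gamma>) * mpower a \<gamma>)"
proof -
  have "mpower (a + b) \<beta>
      = (\<Prod>j\<in>UNIV. \<Sum>k\<le>\<beta> $ j. of_nat (\<beta> $ j choose k) * (a $ j) ^ k * (b $ j) ^ (\<beta> $ j - k))"
    unfolding mpower_def by (intro prod.cong) (simp_all add: binomial_ring)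
  also have "\<dots> = (\<Sum>g\<in>(\<Pi>\<^sub>E j\<in>UNIV. {..\<beta> $ j}). \<Prod>j\<in>UNIV.
      of_nat (\<beta> $ j choose g j) * (a $ j) ^ g j * (b $ j) ^ (\<beta> $ j - g j))"
    by (subst prod_sum_PiE) auto
  also have "\<dots> = (\<Sum>g\<in>(\<Pi>\<^sub>E j\<in>UNIV. {..\<beta> $ j}).
      mbinom \<beta> (vec_lambda g) * mpower b (\<beta> - vec_lambda g) * mpower a (vec_lambda g))"
  proof (intro sum.cong refl)
    fix g assume g: "g \<in> (\<Pi>\<^sub>E j\<in>UNIV. {..\<beta> $ j})"
    have "mbinom \<beta> (vec_lambda g) = (\<Prod>j\<in>UNIV. of_nat (\<beta> $ j choose g j))"
      unfolding mbinom_def mfact_def of_nat_prod prod.distrib [symmetric] prod_dividef [symmetric]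
      by (intro prod.cong) (use g in \<open>auto simp: binomial_fact PiE_iff\<close>)
    then show "(\<Prod>j\<in>UNIV. of_nat (\<beta> $ j choose g j) * (a $ j) ^ g j * (b $ j) ^ (\<beta> $ j - g j))
        = mbinom \<beta> (vec_lambda g) * mpower b (\<beta> - vec_lambda g) * mpower a (vec_lambda g)"
      by (simp add: mpower_def prod.distrib)
  qed
  also have "\<dots> = (\<Sum>\<gamma> | \<gamma> \<le> \<beta>. mbinom \<beta> \<gamma> * mpower b (\<beta> - \<gamma>) * mpower a \<gamma>)"
    unfolding multiindices_below_eq_image
    by (subst sum.reindex) (auto simp: inj_on_def vec_lambda_inject)
  finally show ?thesis .
qed

text \<open>
The effect on moments of multiplying by \<open>wave b\<close>, i.e. of translating all frequencies by \<open>b\<close>: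
Leibniz' rule in terms of moments.
\<close>

definition binomial_transform ::
  "real ^ 'd \<Rightarrow> (nat ^ 'd \<Rightarrow> complex) \<Rightarrow> nat ^ 'd::finite \<Rightarrow> complex" where
  "binomial_transform b \<nu> \<beta>
     = (\<Sum>\<gamma> | \<gamma> \<le> \<beta>. of_real (mbinom \<beta> \<gamma> * mpower b (\<beta> - \<gamma>)) * \<nu> \<gamma>)"

lemma moment_wave_times:
  assumes "exp_poly L f"
  shows "moment \<beta> (\<lambda>\<xi>. wave b \<xi> * f \<xi>) = binomial_transform b (\<lambda>\<gamma>. moment \<gamma> f) \<beta>"
  unfolding binomial_transform_def
  using assms
proof (induction rule: exp_poly.induct)
  case (exp_poly_step a f z)
  have "moment \<beta> (\<lambda>\<xi>. wave b \<xi> * (z * wave a \<xi> + f \<xi>))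
      = moment \<beta> (\<lambda>\<xi>. z * wave (a + b) \<xi> + wave b \<xi> * f \<xi>)"
    by (simp add: wave_add algebra_simps)
  also have "\<dots> = z * of_real (mpower (a + b) \<beta>) + moment \<beta> (\<lambda>\<xi>. wave b \<xi> * f \<xi>)"
    by (subst moment_add[where L = UNIV and L' = UNIV])
      (auto intro: exp_poly_scale exp_poly_wave exp_poly_wave_times[OF exp_poly_step.hyps(2)]
         simp: moment_scale_wave)
  also have "\<dots> = (\<Sum>\<gamma> | \<gamma> \<le> \<beta>. of_real (mbinom \<beta> \<gamma> * mpower b (\<beta> - \<gamma>)) *
      (z * of_real (mpower a \<gamma>) + moment \<gamma> f))"
    unfolding exp_poly_step.IH
    by (simp add: mpower_add sum_distrib_left distrib_left sum.distrib mult_ac)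
  also have "\<dots> = (\<Sum>\<gamma> | \<gamma> \<le> \<beta>. of_real (mbinom \<beta> \<gamma> * mpower b (\<beta> - \<gamma>)) *
      moment \<gamma> (\<lambda>\<xi>. z * wave a \<xi> + f \<xi>))"
    by (subst moment_add[where L = UNIV and L' = L])
      (auto intro: exp_poly_scale exp_poly_wave exp_poly_step.hyps(2) simp: moment_scale_wave)
  finally show ?case .
qed simp

section \<open>Exponential sums that vanish to high order at the origin\<close>

text \<open>
Vanishing to order \<open>n\<close> at the origin.
\<close>

definition flat :: "nat \<Rightarrow> (real ^ 'd::finite \<Rightarrow> complex) \<Rightarrow> bool" where
  "flat n f \<longleftrightarrow> (\<forall>\<beta>. msize \<beta> < n \<longrightarrow> moment \<beta> f = 0)"

lemma flat_add: "exp_poly L f \<Longrightarrow> exp_poly L' g \<Longrightarrow> flat n f \<Longrightarrow> flat n g \<Longrightarrow> flat n (\<lambda>\<xi>. f \<xi> + g \<xi>)"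
  by (simp add: flat_def moment_add)

lemma flat_scale: "exp_poly L f \<Longrightarrow> flat n f \<Longrightarrow> flat n (\<lambda>\<xi>. z * f \<xi>)"
  by (simp add: flat_def moment_scale)

lemma flat_sum:
  "(\<And>i. i \<in> A \<Longrightarrow> exp_poly L (f i)) \<Longrightarrow> (\<And>i. i \<in> A \<Longrightarrow> flat n (f i)) \<Longrightarrow>
    flat n (\<lambda>\<xi>. \<Sum>i\<in>A. f i \<xi>)"
  by (simp add: flat_def moment_sum[where L = L])

lemma flat_reflect: "exp_poly L f \<Longrightarrow> flat n f \<Longrightarrow> flat n (\<lambda>\<xi>. f (- \<xi>))"
  by (simp add: flat_def moment_reflect)

text \<open>
The binomial transform at \<open>\<beta>\<close> only involves moments at \<open>\<gamma> \<le> \<beta>\<close>, which have smaller order.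
\<close>

lemma flat_wave_times:
  assumes "exp_poly L f" "flat n f" shows "flat n (\<lambda>\<xi>. wave b \<xi> * f \<xi>)"
  unfolding flat_def moment_wave_times[OF assms(1)] binomial_transform_def
  using assms(2) by (auto simp: flat_def intro!: sum.neutral dest!: msize_mono)

lemma flat_mult:
  assumes "exp_poly L g" "exp_poly L' f" "flat n f" shows "flat n (\<lambda>\<xi>. g \<xi> * f \<xi>)"
  using assms
proof (induction rule: exp_poly.induct)
  case (exp_poly_step a g z)
  have "flat n (\<lambda>\<xi>. z * (wave a \<xi> * f \<xi>) + g \<xi> * f \<xi>)"
  proof (rule flat_add)
    show "exp_poly UNIV (\<lambda>\<xi>. g \<xi> * f \<xi>)"
      using exp_poly_step by (intro exp_poly_mult[of L g L' f]) auto
    show *: "exp_poly UNIV (\<lambda>\<xi>. z * (wave a \<xi> * f \<xi>))"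
      using exp_poly_step by (intro exp_poly_scale exp_poly_wave_times[of L' f]) auto
    have "exp_poly UNIV (\<lambda>\<xi>. wave a \<xi> * f \<xi>)"
      using exp_poly_step by (intro exp_poly_wave_times[of L' f]) auto
    then show "flat n (\<lambda>\<xi>. z * (wave a \<xi> * f \<xi>))"
      using exp_poly_step flat_scale flat_wave_times by blast
  qed (use exp_poly_step in auto)
  then show ?case by (simp add: algebra_simps)
qed (simp add: flat_def)

definition coord_upd :: "nat ^ 'd \<Rightarrow> 'd \<Rightarrow> nat \<Rightarrow> nat ^ 'd" where
  "coord_upd \<beta> j k = (\<chi> i. if i = j then k else \<beta> $ i)"

lemma msize_coord_upd: "msize (coord_upd \<beta> j k) + \<beta> $ j = msize \<beta> + k"
proof -
  have "msize \<gamma> = \<gamma> $ j + (\<Sum>i\<in>UNIV - {j}. \<gamma> $ i)" for \<gamma> :: "nat ^ 'a"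
    unfolding msize_def by (rule sum.remove) auto
  from this[of \<beta>] this[of "coord_upd \<beta> j k"] show ?thesis
    by (simp add: coord_upd_def)
qed

text \<open>
Translating frequencies along one coordinate axis mixes only the moments that differ in that
coordinate, so the univariate binomial theorem suffices.
\<close>

lemma moment_axis_times:
  assumes "exp_poly L f"
  shows "moment \<beta> (\<lambda>\<xi>. wave (axis j 1) \<xi> * f \<xi>)
    = (\<Sum>k\<le>\<beta> $ j. of_nat (\<beta> $ j choose k) * moment (coord_upd \<beta> j k) f)"
  using assms
proof (induction rule: exp_poly.induct)
  case (exp_poly_step a f z)
  have split: "mpower b \<gamma> = (b $ j) ^ (\<gamma> $ j) * (\<Prod>i\<in>UNIV - {j}. (b $ i) ^ (\<gamma> $ i))"
    for b :: "real ^ 'a" and \<gamma>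
    unfolding mpower_def by (rule prod.remove) auto
  have "mpower (axis j 1 + a) \<beta> = (\<Sum>k\<le>\<beta> $ j. of_nat (\<beta> $ j choose k) * mpower a (coord_upd \<beta> j k))"
  proof -
    have "mpower (axis j 1 + a) \<beta> = (a $ j + 1) ^ (\<beta> $ j) * (\<Prod>i\<in>UNIV - {j}. (a $ i) ^ (\<beta> $ i))"
      unfolding split by (auto simp: axis_def add.commute intro!: arg_cong2[of _ _ _ _ "(*)"] prod.cong)
    also have "\<dots> = (\<Sum>k\<le>\<beta> $ j. of_nat (\<beta> $ j choose k) * (a $ j) ^ k) *
        (\<Prod>i\<in>UNIV - {j}. (a $ i) ^ (\<beta> $ i))"
      by (simp add: binomial_ring)
    also have "\<dots> = (\<Sum>k\<le>\<beta> $ j. of_nat (\<beta> $ j choose k) * mpower a (coord_upd \<beta> j k))"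
      unfolding split coord_upd_def
      by (auto simp: sum_distrib_right mult.assoc intro!: sum.cong prod.cong)
    finally show ?thesis .
  qed
  note eq = this
  have "moment \<beta> (\<lambda>\<xi>. wave (axis j 1) \<xi> * (z * wave a \<xi> + f \<xi>))
      = moment \<beta> (\<lambda>\<xi>. z * wave (axis j 1 + a) \<xi> + wave (axis j 1) \<xi> * f \<xi>)"
    by (simp add: wave_add algebra_simps)
  also have "\<dots> = z * of_real (mpower (axis j 1 + a) \<beta>) + moment \<beta> (\<lambda>\<xi>. wave (axis j 1) \<xi> * f \<xi>)"
    by (subst moment_add[where L = UNIV and L' = UNIV])
      (auto intro: exp_poly_scale exp_poly_wave exp_poly_wave_times[OF exp_poly_step.hyps(2)]
         simp: moment_scale_wave)
  also have "\<dots> = (\<Sum>k\<le>\<beta> $ j. of_nat (\<beta> $ j choose k) *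
      (z * of_real (mpower a (coord_upd \<beta> j k)) + moment (coord_upd \<beta> j k) f))"
    by (simp add: exp_poly_step.IH eq sum_distrib_left distrib_left sum.distrib mult.left_commute)
  also have "\<dots> = (\<Sum>k\<le>\<beta> $ j. of_nat (\<beta> $ j choose k) *
      moment (coord_upd \<beta> j k) (\<lambda>\<xi>. z * wave a \<xi> + f \<xi>))"
    by (subst moment_add[where L = UNIV and L' = L])
      (auto intro: exp_poly_scale exp_poly_wave exp_poly_step.hyps(2) simp: moment_scale_wave)
  finally show ?case .
qed simp

text \<open>
The top term of the binomial sum cancels: a factor \<open>1 - exp (2\<pi>i\<xi>\<^sub>j)\<close> acts on moments like a
finite difference in the \<open>j\<close>-th direction and lowers the order by at least one.
\<close>

lemma moment_diff_axis_times:
  assumes "exp_poly L f"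
  shows "moment \<beta> (\<lambda>\<xi>. (1 - wave (axis j 1) \<xi>) * f \<xi>)
    = - (\<Sum>k<\<beta> $ j. of_nat (\<beta> $ j choose k) * moment (coord_upd \<beta> j k) f)"
proof -
  have "exp_poly UNIV (\<lambda>\<xi>. wave (axis j 1) \<xi> * f \<xi>)"
    by (rule exp_poly_wave_times[OF assms]) simp
  then have "moment \<beta> (\<lambda>\<xi>. f \<xi> - wave (axis j 1) \<xi> * f \<xi>)
      = moment \<beta> f - moment \<beta> (\<lambda>\<xi>. wave (axis j 1) \<xi> * f \<xi>)"
    using assms moment_diff by blast
  moreover have "coord_upd \<beta> j (\<beta> $ j) = \<beta>" by (simp add: coord_upd_def vec_eq_iff)
  ultimately show ?thesis
    by (simp add: moment_axis_times[OF assms] left_diff_distrib lessThan_Suc_atMost [symmetric])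
qed

lemma wave_axis: "wave (axis j 1) \<xi> = exp (2 * complex_of_real pi * \<i> * complex_of_real (\<xi> $ j))"
  by (simp add: wave_def inner_axis')

lemma Pi_poly_alt: "Pi_poly \<alpha> \<xi> = (\<Prod>j\<in>UNIV. (1 - wave (axis j 1) \<xi>) ^ (\<alpha> $ j))"
  by (simp add: Pi_poly_def wave_axis)

lemma Pi_poly_0 [simp]: "Pi_poly 0 \<xi> = 1"
  by (simp add: Pi_poly_def)

lemma Pi_poly_add: "Pi_poly (\<alpha> + \<beta>) \<xi> = Pi_poly \<alpha> \<xi> * Pi_poly \<beta> \<xi>"
  by (simp add: Pi_poly_def power_add prod.distrib)

lemma Pi_poly_axis: "Pi_poly (axis j 1) \<xi> = 1 - wave (axis j 1) \<xi>"
proof -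
  have "Pi_poly (axis j 1) \<xi> = (\<Prod>i\<in>UNIV. if i = j then 1 - wave (axis i 1) \<xi> else 1)"
    unfolding Pi_poly_alt by (intro prod.cong) (auto simp: axis_def)
  then show ?thesis by simp
qed

lemma Pi_poly_uminus: "Pi_poly \<alpha> (- \<xi>) = cnj (Pi_poly \<alpha> \<xi>)"
  by (simp add: Pi_poly_alt cnj_wave)

lemma exp_poly_Pi_poly: "exp_poly int_lattice (Pi_poly \<alpha>)"
proof -
  have "axis j 1 \<in> int_lattice" for j :: 'a by (simp add: int_lattice_iff axis_def)
  then have "exp_poly int_lattice (\<lambda>\<xi>. \<Prod>j\<in>UNIV. (1 - wave (axis j 1) \<xi>) ^ (\<alpha> $ j))"
    by (intro exp_poly_prod exp_poly_power exp_poly_diff exp_poly_const exp_poly_wave) auto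
  then show ?thesis by (simp add: Pi_poly_alt[abs_def])
qed

text \<open>
The leading term of \<open>Pi_poly \<alpha>\<close> at the origin is a nonzero multiple of the monomial with exponent
\<open>\<alpha>\<close>, so among the moments of order \<open>[\<alpha>]\<close> exactly the one at \<open>\<alpha>\<close> survives; its value
is \<open>(-1)\<^bsup>[\<alpha>]\<^esup> \<alpha>!\<close>.
\<close>

lemma moment_Pi_poly:
  "msize \<alpha> = n \<Longrightarrow> flat n (Pi_poly \<alpha>) \<and>
     (\<forall>\<beta>. msize \<beta> = n \<longrightarrow> (moment \<beta> (Pi_poly \<alpha>) \<noteq> 0 \<longleftrightarrow> \<beta> = \<alpha>))"
proof (induction n arbitrary: \<alpha>)
  case 0
  then show ?case by (simp add: flat_def moment_zero_multiindex)
next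
  case (Suc n)
  then have "\<alpha> \<noteq> 0" by auto
  then obtain j where j: "\<alpha> $ j > 0" by (auto simp: vec_eq_iff)
  define \<gamma> where "\<gamma> = coord_upd \<alpha> j (\<alpha> $ j - 1)"
  have \<alpha>: "\<alpha> = axis j 1 + \<gamma>"
    using j by (auto simp: \<gamma>_def coord_upd_def vec_eq_iff axis_def)
  have \<gamma>: "msize \<gamma> = n" using Suc.prems by (simp add: \<alpha> msize_add msize_axis)
  have flat: "flat n (Pi_poly \<gamma>)"
    and kron: "\<And>\<beta>. msize \<beta> = n \<Longrightarrow> moment \<beta> (Pi_poly \<gamma>) \<noteq> 0 \<longleftrightarrow> \<beta> = \<gamma>"
    using Suc.IH[OF \<gamma>] by auto
  have "Pi_poly \<alpha> = (\<lambda>\<xi>. (1 - wave (axis j 1) \<xi>) * Pi_poly \<gamma> \<xi>)"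
    by (simp add: fun_eq_iff \<alpha> Pi_poly_add Pi_poly_axis del: One_nat_def)
  then have mom: "moment \<beta> (Pi_poly \<alpha>)
      = - (\<Sum>k<\<beta> $ j. of_nat (\<beta> $ j choose k) * moment (coord_upd \<beta> j k) (Pi_poly \<gamma>))" for \<beta>
    by (simp add: moment_diff_axis_times[OF exp_poly_Pi_poly])
  have "flat (Suc n) (Pi_poly \<alpha>)"
    unfolding flat_def
  proof (intro allI impI)
    fix \<beta> :: "nat ^ 'a" assume \<beta>: "msize \<beta> < Suc n"
    have "moment (coord_upd \<beta> j k) (Pi_poly \<gamma>) = 0" if "k < \<beta> $ j" for k
      using flat msize_coord_upd[of \<beta> j k] \<beta> that by (simp add: flat_def)
    then show "moment \<beta> (Pi_poly \<alpha>) = 0" by (simp add: mom)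
  qed
  moreover have "moment \<beta> (Pi_poly \<alpha>) \<noteq> 0 \<longleftrightarrow> \<beta> = \<alpha>" if \<beta>: "msize \<beta> = Suc n" for \<beta>
  proof (cases "\<beta> $ j")
    case 0
    then show ?thesis using j by (auto simp: mom)
  next
    case (Suc r)
    \<comment> \<open>Only the summand with \<open>k = \<beta>\<^sub>j - 1\<close> has order \<open>n\<close>; the others have smaller order.\<close>
    have "moment (coord_upd \<beta> j k) (Pi_poly \<gamma>) = 0" if "k < r" for k
      using flat msize_coord_upd[of \<beta> j k] \<beta> that Suc by (simp add: flat_def)
    then have "moment \<beta> (Pi_poly \<alpha>) = - of_nat (Suc r) * moment (coord_upd \<beta> j r) (Pi_poly \<gamma>)"
      by (simp add: mom Suc algebra_simps)
    then have "moment \<beta> (Pi_poly \<alpha>) \<noteq> 0 \<longleftrightarrow> moment (coord_upd \<beta> j r) (Pi_poly \<gamma>) \<noteq> 0"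
      by (simp del: of_nat_Suc)
    also have "\<dots> \<longleftrightarrow> coord_upd \<beta> j r = \<gamma>"
      using msize_coord_upd[of \<beta> j r] \<beta> Suc by (intro kron) simp
    also have "\<dots> \<longleftrightarrow> \<beta> = \<alpha>"
    proof
      assume "coord_upd \<beta> j r = \<gamma>"
      then have eq: "coord_upd \<beta> j r $ i = \<gamma> $ i" for i by simp
      have "\<beta> $ i = \<alpha> $ i" for i
        using eq[of i] Suc j by (cases "i = j") (simp_all add: \<gamma>_def coord_upd_def)
      then show "\<beta> = \<alpha>" by (simp add: vec_eq_iff)
    qed (use Suc in \<open>simp add: \<gamma>_def\<close>)
    finally show ?thesis .
  qed
  ultimately show ?case by blast
qed

text \<open>
The \<open>n\<close>-th power of the ideal of trigonometric polynomials that vanish at the origin, given by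
its generators.
\<close>

definition Pi_span :: "nat \<Rightarrow> (real ^ 'd::finite \<Rightarrow> complex) \<Rightarrow> bool" where
  "Pi_span n f \<longleftrightarrow> (\<exists>T. (\<forall>\<alpha>. exp_poly int_lattice (T \<alpha>)) \<and>
     f = (\<lambda>\<xi>. \<Sum>\<alpha> | msize \<alpha> = n. T \<alpha> \<xi> * Pi_poly \<alpha> \<xi>))"

lemma Pi_span_0: "Pi_span n (\<lambda>\<xi>. 0)"
  unfolding Pi_span_def by (rule exI[of _ "\<lambda>_ _. 0"]) simp

lemma Pi_span_add: "Pi_span n f \<Longrightarrow> Pi_span n g \<Longrightarrow> Pi_span n (\<lambda>\<xi>. f \<xi> + g \<xi>)"
  unfolding Pi_span_def
proof safe
  fix T S :: "nat ^ 'a \<Rightarrow> real ^ 'a \<Rightarrow> complex"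
  assume "\<forall>\<alpha>. exp_poly int_lattice (T \<alpha>)" "\<forall>\<alpha>. exp_poly int_lattice (S \<alpha>)"
  then show "\<exists>R. (\<forall>\<alpha>. exp_poly int_lattice (R \<alpha>)) \<and>
      (\<lambda>\<xi>. (\<Sum>\<alpha> | msize \<alpha> = n. T \<alpha> \<xi> * Pi_poly \<alpha> \<xi>) + (\<Sum>\<alpha> | msize \<alpha> = n. S \<alpha> \<xi> * Pi_poly \<alpha> \<xi>))
      = (\<lambda>\<xi>. \<Sum>\<alpha> | msize \<alpha> = n. R \<alpha> \<xi> * Pi_poly \<alpha> \<xi>)"
    by (intro exI[of _ "\<lambda>\<alpha> \<xi>. T \<alpha> \<xi> + S \<alpha> \<xi>"])
      (auto intro: exp_poly_add simp: distrib_right sum.distrib)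
qed

lemma Pi_span_sum:
  "(\<And>i. i \<in> A \<Longrightarrow> Pi_span n (f i)) \<Longrightarrow> Pi_span n (\<lambda>\<xi>. \<Sum>i\<in>A. f i \<xi>)"
  by (induction A rule: infinite_finite_induct) (auto intro: Pi_span_add Pi_span_0)

lemma exp_poly_int_mult:
  "exp_poly int_lattice f \<Longrightarrow> exp_poly int_lattice g \<Longrightarrow> exp_poly int_lattice (\<lambda>\<xi>. f \<xi> * g \<xi>)"
  by (erule exp_poly_mult) (auto intro: int_lattice_add)

lemma Pi_span_times_Pi_poly:
  assumes "exp_poly int_lattice t" "msize \<alpha> = n"
  shows "Pi_span n (\<lambda>\<xi>. t \<xi> * Pi_poly \<alpha> \<xi>)"
  unfolding Pi_span_def
proof (intro exI[of _ "\<lambda>\<beta> \<xi>. if \<beta> = \<alpha> then t \<xi> else 0"] conjI allI)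
  fix \<beta> show "exp_poly int_lattice (\<lambda>\<xi>. if \<beta> = \<alpha> then t \<xi> else 0)"
    using assms by (cases "\<beta> = \<alpha>") auto
  show "(\<lambda>\<xi>. t \<xi> * Pi_poly \<alpha> \<xi>)
      = (\<lambda>\<xi>. \<Sum>\<beta> | msize \<beta> = n. (if \<beta> = \<alpha> then t \<xi> else 0) * Pi_poly \<beta> \<xi>)"
    using assms by (simp add: if_distrib[of "\<lambda>z. z * _"] cong: if_cong)
qed

lemma Pi_span_mult:
  assumes "Pi_span n f" "Pi_span k g" shows "Pi_span (n + k) (\<lambda>\<xi>. f \<xi> * g \<xi>)"
proof -
  obtain T where T: "\<And>\<alpha>. exp_poly int_lattice (T \<alpha>)"
    and f: "f = (\<lambda>\<xi>. \<Sum>\<alpha> | msize \<alpha> = n. T \<alpha> \<xi> * Pi_poly \<alpha> \<xi>)"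
    using assms(1) by (auto simp: Pi_span_def)
  obtain S where S: "\<And>\<alpha>. exp_poly int_lattice (S \<alpha>)"
    and g: "g = (\<lambda>\<xi>. \<Sum>\<alpha> | msize \<alpha> = k. S \<alpha> \<xi> * Pi_poly \<alpha> \<xi>)"
    using assms(2) by (auto simp: Pi_span_def)
  have "Pi_span (n + k) (\<lambda>\<xi>. \<Sum>\<alpha> | msize \<alpha> = n. \<Sum>\<beta> | msize \<beta> = k.
      (T \<alpha> \<xi> * S \<beta> \<xi>) * Pi_poly (\<alpha> + \<beta>) \<xi>)"
    by (intro Pi_span_sum Pi_span_times_Pi_poly exp_poly_int_mult T S) (simp add: msize_add)
  then show ?thesis
    by (simp add: f g sum_product Pi_poly_add mult.assoc mult.left_commute)
qed

lemma Pi_span_zero_order: "exp_poly int_lattice f \<Longrightarrow> Pi_span 0 f"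
  using Pi_span_times_Pi_poly[of f 0 0] by simp

lemma Pi_span_exp_poly_times:
  "exp_poly int_lattice f \<Longrightarrow> Pi_span n g \<Longrightarrow> Pi_span n (\<lambda>\<xi>. f \<xi> * g \<xi>)"
  using Pi_span_mult[OF Pi_span_zero_order, of f n g] by simp

lemma flat_Pi_span: "Pi_span n f \<Longrightarrow> flat n f"
  unfolding Pi_span_def
  by (auto intro!: flat_sum[where L = int_lattice] exp_poly_int_mult exp_poly_Pi_poly
      flat_mult[where L = int_lattice and L' = int_lattice] simp: moment_Pi_poly)

lemma exp_poly_Pi_span: "Pi_span n f \<Longrightarrow> exp_poly int_lattice f"
  unfolding Pi_span_def by (auto intro!: exp_poly_sum exp_poly_int_mult exp_poly_Pi_poly)

text \<open>
The frequencies \<open>a\<close> for which \<open>wave a - 1\<close> lies in the ideal form a subgroup, since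
\<open>wave (a + b) - 1 = (wave a - 1) + wave a * (wave b - 1)\<close>, and it contains the unit vectors.
\<close>

lemma Pi_span_wave_diff_1:
  "Pi_span 1 (\<lambda>\<xi>. wave (of_int_vec k) \<xi> - 1)"
proof -
  define P where "P a \<longleftrightarrow> a \<in> int_lattice \<and> Pi_span 1 (\<lambda>\<xi>. wave a \<xi> - 1)" for a :: "real ^ 'a"
  have P_0: "P 0" by (simp add: P_def Pi_span_0)
  have P_add: "P (a + b)" if "P a" "P b" for a b
  proof -
    have "Pi_span 1 (\<lambda>\<xi>. (wave a \<xi> - 1) + wave a \<xi> * (wave b \<xi> - 1))"
      using that by (intro Pi_span_add Pi_span_exp_poly_times exp_poly_wave) (auto simp: P_def)
    then show ?thesis using that by (simp add: P_def wave_add algebra_simps int_lattice_add)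
  qed
  have P_axis: "P (axis j 1)" "P (- axis j 1)" for j
  proof -
    have int: "axis j 1 \<in> int_lattice" by (simp add: int_lattice_iff axis_def)
    have "Pi_span 1 (\<lambda>\<xi>. (- 1) * Pi_poly (axis j 1) \<xi>)"
      by (intro Pi_span_times_Pi_poly exp_poly_const) (simp_all add: msize_axis)
    then show "P (axis j 1)" by (simp add: P_def int Pi_poly_axis del: One_nat_def)
    have "Pi_span 1 (\<lambda>\<xi>. wave (- axis j 1) \<xi> * Pi_poly (axis j 1) \<xi>)"
      using int by (intro Pi_span_times_Pi_poly exp_poly_wave) (simp_all add: msize_axis int_lattice_uminus)
    then show "P (- axis j 1)"
      by (simp add: P_def int int_lattice_uminus Pi_poly_axis wave_uminus algebra_simps del: One_nat_def)
  qed
  have P_line: "P (of_int z *\<^sub>R axis j 1)" for z j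
  proof (induction z rule: int_induct[of _ 0])
    case (step1 i)
    then show ?case using P_add[OF _ P_axis(1)] by (simp add: scaleR_left_distrib)
  next
    case (step2 i)
    then show ?case using P_add[OF _ P_axis(2)] by (simp add: scaleR_left_diff_distrib)
  qed (simp add: P_0)
  have "P (\<Sum>j\<in>A. of_int (k $ j) *\<^sub>R axis j 1)" for A
    by (induction A rule: infinite_finite_induct) (auto intro: P_0 P_add P_line)
  moreover have "of_int_vec k = (\<Sum>j\<in>UNIV. of_int (k $ j) *\<^sub>R axis j 1)"
    by (simp add: vec_eq_iff axis_def if_distrib cong: if_cong)
  ultimately show ?thesis by (metis P_def)
qed

lemma Pi_span_diff_value_at_0: "exp_poly int_lattice f \<Longrightarrow> Pi_span 1 (\<lambda>\<xi>. f \<xi> - f 0)"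
proof (induction rule: exp_poly.induct)
  case (exp_poly_step a f z)
  have "Pi_span 1 (\<lambda>\<xi>. wave a \<xi> - 1)"
    using exp_poly_step.hyps(1) Pi_span_wave_diff_1 by (auto simp: int_lattice_def)
  then have "Pi_span 1 (\<lambda>\<xi>. z * (wave a \<xi> - 1) + (f \<xi> - f 0))"
    by (intro Pi_span_add Pi_span_exp_poly_times exp_poly_const exp_poly_step.IH) auto
  then show ?case by (simp add: algebra_simps)
qed (simp add: Pi_span_0)

text \<open>
Induction on the order. Given an expansion of order \<open>n\<close>, replacing each coefficient by its value
at the origin changes the sum by an element of the next power of the ideal. The constant
coefficients that remain are read off by the moments of order \<open>n\<close>, because of
\<open>moment_Pi_poly\<close>; if those moments vanish, so do the constants.
\<close>

lemma flat_imp_Pi_span: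
  assumes "exp_poly int_lattice f" "flat n f" shows "Pi_span n f"
  using assms(2)
proof (induction n)
  case 0
  show ?case by (rule Pi_span_zero_order) fact
next
  case (Suc n)
  then have "flat n f" by (simp add: flat_def)
  then obtain T where T: "\<And>\<alpha>. exp_poly int_lattice (T \<alpha>)"
    and f: "f = (\<lambda>\<xi>. \<Sum>\<alpha> | msize \<alpha> = n. T \<alpha> \<xi> * Pi_poly \<alpha> \<xi>)"
    using Suc.IH unfolding Pi_span_def by blast
  define r where "r = (\<lambda>\<xi>. \<Sum>\<alpha> | msize \<alpha> = n. (T \<alpha> \<xi> - T \<alpha> 0) * Pi_poly \<alpha> \<xi>)"
  have "Pi_span (1 + n) (\<lambda>\<xi>. (T \<alpha> \<xi> - T \<alpha> 0) * (1 * Pi_poly \<alpha> \<xi>))" if "msize \<alpha> = n" for \<alpha>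
    using that T
    by (intro Pi_span_mult Pi_span_diff_value_at_0 Pi_span_times_Pi_poly exp_poly_const) auto
  then have r: "Pi_span (Suc n) r"
    unfolding r_def by (intro Pi_span_sum) simp
  have rest: "f \<xi> - r \<xi> = (\<Sum>\<alpha> | msize \<alpha> = n. T \<alpha> 0 * Pi_poly \<alpha> \<xi>)" for \<xi>
    by (simp add: f r_def sum_subtractf [symmetric] algebra_simps)
  have "T \<alpha> 0 = 0" if \<alpha>: "msize \<alpha> = n" for \<alpha>
  proof -
    have "0 = moment \<alpha> (\<lambda>\<xi>. f \<xi> - r \<xi>)"
      using Suc.prems flat_Pi_span[OF r] \<alpha> moment_diff[OF assms(1) exp_poly_Pi_span[OF r]]
      by (simp add: flat_def)
    also have "\<dots> = (\<Sum>\<beta> | msize \<beta> = n. T \<beta> 0 * moment \<alpha> (Pi_poly \<beta>))"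
      by (simp add: rest moment_sum[where L = int_lattice] exp_poly_scale exp_poly_Pi_poly
          moment_scale[OF exp_poly_Pi_poly])
    also have "\<dots> = (\<Sum>\<beta> | msize \<beta> = n. if \<beta> = \<alpha> then T \<beta> 0 * moment \<alpha> (Pi_poly \<beta>) else 0)"
      by (rule sum.cong) (use \<alpha> moment_Pi_poly in \<open>auto\<close>)
    also have "\<dots> = T \<alpha> 0 * moment \<alpha> (Pi_poly \<alpha>)" using \<alpha> by simp
    finally show ?thesis using moment_Pi_poly[OF \<alpha>] \<alpha> by auto
  qed
  with rest have "f = r" by (simp add: fun_eq_iff)
  with r show ?case by simp
qed

section \<open>Integer matrices acting on the lattice\<close>

lemma det_map_matrix_of_int:
  "det (map_matrix of_int M :: 'a::comm_ring_1 ^ 'd ^ 'd::finite) = of_int (det M)"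
  by (simp add: det_def)

text \<open>
A singular matrix has the eigenvalue \<open>0\<close>, which does not lie outside the unit circle.
\<close>

lemma matrix_dilation_det_nonzero:
  fixes M :: "int ^ 'd ^ 'd::finite"
  assumes "matrix_dilation M" shows "det M \<noteq> 0"
proof
  assume "det M = 0"
  then have "det (map_matrix of_int M :: complex ^ 'd ^ 'd) = 0"
    by (simp add: det_map_matrix_of_int)
  then have "\<not> (\<exists>B. B ** (map_matrix of_int M :: complex ^ 'd ^ 'd) = mat 1)"
    using invertible_det_nz invertible_left_inverse by blast
  then obtain v :: "complex ^ 'd" where "v \<noteq> 0" "map_matrix of_int M *v v = 0"
    unfolding matrix_left_invertible_ker by blast
  then have "norm (0 :: complex) > 1"
    using assms unfolding matrix_dilation_def
    by (metis vector_smult_lzero)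
  then show False by simp
qed

lemma det_transpose_int: "det (transpose M) = det M" for M :: "int ^ 'd ^ 'd::finite"
proof -
  have "real_of_int (det (transpose M)) = det (transpose (map_matrix of_int M :: real ^ 'd ^ 'd))"
    unfolding det_map_matrix_of_int [symmetric]
    by (rule arg_cong[of _ _ det]) (simp add: vec_eq_iff transpose_def map_matrix_def)
  then show ?thesis
    by (simp add: det_transpose det_map_matrix_of_int)
qed

lemma mapply_diff: "mapply M (x - y) = mapply M x - mapply M y"
  by (simp add: mapply_def matrix_vector_mult_diff_distrib)

lemma mapply_uminus: "mapply M (- x) = - mapply M x"
  using mapply_diff[of M 0 x] by (simp add: mapply_def)

lemma mapply_0 [simp]: "mapply M 0 = 0"
  by (simp add: mapply_def)

lemma mapply_of_int_vec: "mapply M (of_int_vec y) = of_int_vec (M *v y)"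
  by (simp add: mapply_def vec_eq_iff matrix_vector_mult_def map_matrix_def)

lemma mapply_int_lattice: "x \<in> int_lattice \<Longrightarrow> mapply M x \<in> int_lattice"
  by (auto simp: int_lattice_def mapply_of_int_vec)

lemma mapply_adjoint: "mapply M x \<bullet> y = x \<bullet> mapply (transpose M) y"
proof -
  have "map_matrix of_int (transpose M) = transpose (map_matrix of_int M :: real ^ 'a ^ 'a)"
    by (simp add: vec_eq_iff transpose_def map_matrix_def)
  then show ?thesis
    by (simp add: mapply_def transpose_matrix_vector dot_lmul_matrix inner_commute)
      (metis dot_lmul_matrix inner_commute)
qed

text \<open>
Substituting \<open>M\<^sup>* \<xi>\<close> into a wave applies \<open>M\<close> to its frequency.
\<close>

lemma wave_mapply: "wave (mapply M a) \<xi> = wave a (mapply (transpose M) \<xi>)"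
  by (simp add: wave_def mapply_adjoint)

lemma mapply_inv_add: "mapply_inv M (x + y) = mapply_inv M x + mapply_inv M y"
  by (simp add: mapply_inv_def matrix_vector_right_distrib)

lemma mapply_inv_diff: "mapply_inv M (x - y) = mapply_inv M x - mapply_inv M y"
  by (simp add: mapply_inv_def matrix_vector_mult_diff_distrib)

lemma
  assumes "det M \<noteq> 0"
  shows mapply_mapply_inv: "mapply M (mapply_inv M x) = x"
    and mapply_inv_mapply: "mapply_inv M (mapply M x) = x"
proof -
  have "invertible (map_matrix of_int M :: real ^ 'a ^ 'a)"
    using assms by (simp add: invertible_det_nz det_map_matrix_of_int)
  then have "map_matrix of_int M ** matrix_inv (map_matrix of_int M :: real ^ 'a ^ 'a) = mat 1"
    "matrix_inv (map_matrix of_int M :: real ^ 'a ^ 'a) ** map_matrix of_int M = mat 1"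
    unfolding invertible_def matrix_inv_def by (metis (mono_tags, lifting) someI_ex)+
  then show "mapply M (mapply_inv M x) = x" "mapply_inv M (mapply M x) = x"
    by (simp_all add: mapply_def mapply_inv_def matrix_vector_mul_assoc)
qed

lemma wave_mapply_inv:
  assumes "det M \<noteq> 0"
  shows "wave (mapply_inv M a) \<xi> = wave a (mapply_inv (transpose M) \<xi>)"
proof -
  have "det (transpose M) \<noteq> 0" using assms by (simp add: det_transpose_int)
  then show ?thesis
    using wave_mapply[of M "mapply_inv M a" "mapply_inv (transpose M) \<xi>"] assms
    by (simp add: mapply_mapply_inv)
qed

lemma mapply_inv_in_int_lattice_iff:
  assumes "det M \<noteq> 0"
  shows "mapply_inv M (of_int_vec k) \<in> int_lattice \<longleftrightarrow> (\<exists>y. k = M *v y)"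
proof
  assume "mapply_inv M (of_int_vec k) \<in> int_lattice"
  then obtain y where "mapply_inv M (of_int_vec k) = of_int_vec y"
    by (auto simp: int_lattice_def)
  then have "of_int_vec k = mapply M (of_int_vec y)"
    using mapply_mapply_inv[OF assms, of "of_int_vec k"] by simp
  then show "\<exists>y. k = M *v y" by (auto simp: mapply_of_int_vec)
next
  assume "\<exists>y. k = M *v y"
  then show "mapply_inv M (of_int_vec k) \<in> int_lattice"
    by (auto simp: mapply_of_int_vec [symmetric] mapply_inv_mapply[OF assms])
qed

text \<open>
Cramer's rule over the integers: \<open>det N\<close> annihilates the quotient of the lattice by the image of
\<open>N\<close>. This is what makes digit sets finite.
\<close>

lemma det_smult_in_image:
  fixes N :: "int ^ 'd ^ 'd::finite"
  assumes "det N \<noteq> 0"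
  shows "\<exists>y. N *v y = det N *s k"
proof -
  define y :: "int ^ 'd" where "y = (\<chi> j. det (\<chi> i l. if l = j then k $ i else N $ i $ l))"
  let ?R = "map_matrix of_int N :: real ^ 'd ^ 'd"
  have nz: "det ?R \<noteq> 0" using assms by (simp add: det_map_matrix_of_int)
  have "det (\<chi> i l. if l = j then of_int_vec k $ i else ?R $ i $ l) = of_int (y $ j)" for j
    unfolding y_def vec_lambda_beta det_map_matrix_of_int [symmetric]
    by (rule arg_cong[of _ _ det]) (simp add: vec_eq_iff map_matrix_def)
  then have "?R *v (\<chi> j. of_int (y $ j) / det ?R) = of_int_vec k"
    using cramer[OF nz, of "\<chi> j. of_int (y $ j) / det ?R" "of_int_vec k"] by simp
  moreover have "of_int_vec y = det ?R *s (\<chi> j. of_int (y $ j) / det ?R)"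
    using nz by (simp add: vec_eq_iff)
  ultimately have "of_int_vec (N *v y) = det ?R *s of_int_vec k"
    by (simp add: mapply_of_int_vec [symmetric] mapply_def matrix_vector_mult_scaleR
        vector_scalar_commute)
  then have "N *v y = det N *s k"
    by (simp add: vec_eq_iff det_map_matrix_of_int flip: of_int_mult)
  then show ?thesis by blast
qed

section \<open>Character sums over digit sets\<close>

lemma digit_set_unique:
  assumes "digit_set M D" "x \<in> D" "y \<in> D" "x - y = M *v z"
  shows "x = y"
proof -
  have "\<exists>!s. s \<in> D \<and> (\<exists>y. x - s = M *v y)"
    using assms(1) by (simp add: digit_set_def)
  moreover have "x - x = M *v 0" by simp
  ultimately show ?thesis using assms(2-4) by blast
qed

text \<open>
Two digits that agree modulo \<open>det N\<close> in every coordinate represent the same coset, so a digit set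
embeds into a finite box of residues.
\<close>

lemma digit_set_finite:
  fixes N :: "int ^ 'd ^ 'd::finite"
  assumes "det N \<noteq> 0" "digit_set N D" shows "finite D"
proof -
  define r where "r x = (\<chi> i. x $ i mod \<bar>det N\<bar>)" for x :: "int ^ 'd"
  have "inj_on r D"
  proof (rule inj_onI)
    fix x y assume xy: "x \<in> D" "y \<in> D" "r x = r y"
    have "det N dvd x $ i - y $ i" for i
    proof -
      have "r x $ i = r y $ i" using xy by simp
      then have "x $ i mod \<bar>det N\<bar> = y $ i mod \<bar>det N\<bar>" by (simp add: r_def)
      then show ?thesis by (simp add: mod_eq_dvd_iff)
    qed
    then have "x - y = det N *s (\<chi> i. (x $ i - y $ i) div det N)"
      by (simp add: vec_eq_iff)
    then obtain z where "x - y = N *v z"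
      using det_smult_in_image[OF assms(1)] by metis
    then show "x = y" using digit_set_unique[OF assms(2)] xy by blast
  qed
  moreover have "finite (r ` D)"
  proof (rule finite_subset)
    show "r ` D \<subseteq> vec_lambda ` (\<Pi>\<^sub>E i\<in>UNIV. {0..<\<bar>det N\<bar>})"
      using assms(1) by (auto simp: r_def intro!: imageI)
  qed (intro finite_imageI finite_PiE, auto)
  ultimately show ?thesis by (rule finite_imageD[rotated])
qed

text \<open>
The function \<open>x \<mapsto> wave a x\<close> is a character of \<open>\<int>\<^sup>d / M \<int>\<^sup>d\<close> because \<open>M\<^sup>* a\<close> is integral, and it is
nontrivial because some unit vector \<open>e\<close> has \<open>wave a e \<noteq> 1\<close>. Translation by \<open>e\<close> permutes the cosets
and multiplies the sum by \<open>wave a e\<close>, so the sum vanishes.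
\<close>

lemma digit_character_sum:
  fixes M :: "int ^ 'd ^ 'd::finite"
  assumes D: "digit_set M D"
    and dual: "mapply (transpose M) a \<in> int_lattice" and nontriv: "a \<notin> int_lattice"
  shows "(\<Sum>x\<in>D. wave a (of_int_vec x)) = 0"
proof -
  let ?w = "\<lambda>x. wave a (of_int_vec x)"
  obtain j where j: "a $ j \<notin> \<int>" using nontriv by (auto simp: int_lattice_iff)
  define e :: "int ^ 'd" where "e = axis j 1"
  have e: "?w e \<noteq> 1"
    using j by (simp add: e_def of_int_vec_axis wave_eq_1_iff inner_axis)
  have shift: "?w (x + e) = ?w e * ?w x" for x
    by (simp add: of_int_vec_add wave_add_right)
  define r where "r x = (THE s. s \<in> D \<and> (\<exists>y. x - s = M *v y))" for x
  have r: "r x \<in> D" "\<exists>y. x - r x = M *v y" for x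
  proof -
    have "\<exists>!s. s \<in> D \<and> (\<exists>y. x - s = M *v y)" using D by (simp add: digit_set_def)
    from theI'[OF this] show "r x \<in> D" "\<exists>y. x - r x = M *v y"
      unfolding r_def by auto
  qed
  have r_eq: "r x = t" if "t \<in> D" "\<exists>y. x - t = M *v y" for x t
  proof -
    have "\<exists>!s. s \<in> D \<and> (\<exists>y. x - s = M *v y)" using D by (simp add: digit_set_def)
    then show ?thesis using that r[of x] by blast
  qed
  have w_r: "?w (r x) = ?w x" for x
  proof -
    obtain y where y: "x - r x = M *v y" using r by blast
    have "?w (M *v y) = wave (of_int_vec y) (mapply (transpose M) a)"
      unfolding mapply_of_int_vec [symmetric] wave_def
      by (metis inner_commute mapply_adjoint)
    also have "\<dots> = 1" using dual by (intro wave_int_int) simp_all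
    finally have "?w (r x + M *v y) = ?w (r x)" by (simp add: of_int_vec_add wave_add_right)
    moreover have "r x + M *v y = x" by (simp flip: y)
    ultimately show ?thesis by simp
  qed
  have "(\<Sum>x\<in>D. ?w x) = (\<Sum>x\<in>D. ?w (r (x + e)))"
  proof (rule sum.reindex_bij_witness[of _ "\<lambda>x. r (x + e)" "\<lambda>x. r (x - e)"])
    show "r (r (x + e) - e) = x" if x: "x \<in> D" for x
    proof -
      obtain y where "x + e - r (x + e) = M *v y" using r by blast
      then have "r (x + e) - e - x = M *v (- y)"
        using matrix_vector_mult_diff_distrib[of M 0 y] by (simp add: algebra_simps)
      then show ?thesis using r_eq x by blast
    qed
    show eq: "r (r (x - e) + e) = x" if x: "x \<in> D" for x
    proof -
      obtain y where "x - e - r (x - e) = M *v y" using r by blast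
      then have "r (x - e) + e - x = M *v (- y)"
        using matrix_vector_mult_diff_distrib[of M 0 y] by (simp add: algebra_simps)
      then show ?thesis using r_eq x by blast
    qed
    show "?w (r (r (x - e) + e)) = ?w x" if "x \<in> D" for x using eq[OF that] by simp
  qed (use r in auto)
  also have "\<dots> = ?w e * (\<Sum>x\<in>D. ?w x)" by (simp add: w_r shift sum_distrib_left)
  finally show ?thesis using e by (simp add: mult_cancel_right1)
qed

lemma digit_enum_unique:
  assumes "digit_enum M s" "k < index_det M" "l < index_det M" "s k - s l = M *v y"
  shows "k = l"
  using digit_set_unique[of M "s ` {..<index_det M}" "s k" "s l" y] assms
  by (auto simp: digit_enum_def inj_on_def)

text \<open>
Orthogonality of characters, summed over the dual digits: the frequencies \<open>u k - u l\<close> define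
nontrivial characters of \<open>\<int>\<^sup>d / M\<^sup>* \<int>\<^sup>d\<close> unless \<open>k = l\<close>.
\<close>

lemma polyphase_inversion:
  fixes M :: "int ^ 'd ^ 'd::finite" and s v
  defines "u k \<equiv> mapply_inv M (of_int_vec (s k))"
  assumes det: "det M \<noteq> 0" and s: "digit_enum M s" and Dt: "digit_set (transpose M) Dt"
    and l: "l < index_det M"
  shows "(\<Sum>x\<in>Dt. wave (- u l) (of_int_vec x) * (\<Sum>k<index_det M. wave (u k) (of_int_vec x) * v k))
    = of_nat (card Dt) * v l"
proof -
  have "(\<Sum>x\<in>Dt. wave (u k - u l) (of_int_vec x)) = 0" if k: "k < index_det M" "k \<noteq> l" for k
  proof (rule digit_character_sum[OF Dt])
    have eq: "u k - u l = mapply_inv M (of_int_vec (s k - s l))"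
      by (simp add: u_def mapply_inv_diff of_int_vec_diff)
    show "mapply (transpose (transpose M)) (u k - u l) \<in> int_lattice"
      using det by (simp add: eq mapply_mapply_inv)
    show "u k - u l \<notin> int_lattice"
      unfolding eq mapply_inv_in_int_lattice_iff[OF det]
      using digit_enum_unique[OF s k(1) l] k(2) by blast
  qed
  then have "v k * (\<Sum>x\<in>Dt. wave (u k - u l) (of_int_vec x))
      = (if k = l then of_nat (card Dt) * v l else 0)" if "k < index_det M" for k
    using that by simp
  then have "(\<Sum>k<index_det M. v k * (\<Sum>x\<in>Dt. wave (u k - u l) (of_int_vec x)))
      = of_nat (card Dt) * v l"
    using l by simp
  then show ?thesis
    by (simp add: sum_distrib_left sum.swap[of _ Dt] wave_diff wave_uminus mult_ac)
qed

text \<open>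
The orthogonality relation with the roles of \<open>M\<close> and its transpose exchanged: a nonzero dual
digit defines a nontrivial character of \<open>\<int>\<^sup>d / M \<int>\<^sup>d\<close>.
\<close>

lemma digit_waves_cancel:
  fixes M :: "int ^ 'd ^ 'd::finite"
  assumes det: "det M \<noteq> 0" and s: "digit_enum M s"
    and Dt: "digit_set (transpose M) Dt" "0 \<in> Dt" and x: "x \<in> Dt - {0}"
  shows "(\<Sum>k<index_det M. wave (mapply_inv M (of_int_vec (s k))) (of_int_vec x)) = 0"
proof -
  have det': "det (transpose M) \<noteq> 0" using det by (simp add: det_transpose_int)
  let ?a = "mapply_inv (transpose M) (of_int_vec x)"
  have "(\<Sum>y\<in>s ` {..<index_det M}. wave ?a (of_int_vec y)) = 0"
  proof (rule digit_character_sum)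
    show "digit_set M (s ` {..<index_det M})" using s by (simp add: digit_enum_def)
    show "mapply (transpose M) ?a \<in> int_lattice" by (simp add: mapply_mapply_inv[OF det'])
    show "?a \<notin> int_lattice"
      unfolding mapply_inv_in_int_lattice_iff[OF det']
      using digit_set_unique[OF Dt(1), of x 0] x Dt(2) by auto
  qed
  moreover have "wave ?a (of_int_vec y) = wave (mapply_inv M (of_int_vec y)) (of_int_vec x)" for y
    by (simp add: wave_mapply_inv[OF det]) (simp add: wave_def inner_commute)
  ultimately show ?thesis
    using s by (simp add: sum.reindex digit_enum_def)
qed

section \<open>Pairing of the digits under the symmetry\<close>

text \<open>
The index sought belongs to the digit that represents the coset of the integer vector
\<open>2c - s\<^sub>k\<close>.
\<close>

lemma partner_unique:
  assumes det: "det M \<noteq> 0" and c: "c \<in> half_lattice" and s: "digit_enum M s"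
    and k: "k < index_det M"
  shows "\<exists>!l. l < index_det M \<and>
    mapply_inv M (2 *\<^sub>R c - of_int_vec (s k) - of_int_vec (s l)) \<in> int_lattice"
proof -
  obtain z where z: "2 *\<^sub>R c = of_int_vec z"
    using c by (auto simp: half_lattice_def int_lattice_def)
  have eq: "mapply_inv M (2 *\<^sub>R c - of_int_vec (s k) - of_int_vec (s l)) \<in> int_lattice
      \<longleftrightarrow> (\<exists>y. (z - s k) - s l = M *v y)" for l
    unfolding z of_int_vec_diff [symmetric] mapply_inv_in_int_lattice_iff[OF det] ..
  have ex1: "\<exists>!t. t \<in> s ` {..<index_det M} \<and> (\<exists>y. (z - s k) - t = M *v y)"
    using s by (simp add: digit_enum_def digit_set_def)
  from ex1 obtain l where l: "l < index_det M" "\<exists>y. (z - s k) - s l = M *v y" by blast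
  show ?thesis
    unfolding eq
  proof (rule ex1I[of _ l])
    fix l' assume "l' < index_det M \<and> (\<exists>y. z - s k - s l' = M *v y)"
    then obtain y' where l': "l' < index_det M" "z - s k - s l' = M *v y'" by blast
    obtain y where y: "z - s k - s l = M *v y" using l(2) by blast
    have "s l' - s l = (z - s k - s l) - (z - s k - s l')" by simp
    also have "\<dots> = M *v (y - y')"
      unfolding y l'(2) by (rule matrix_vector_mult_diff_distrib [symmetric])
    finally show "l' = l" by (rule digit_enum_unique[OF s l'(1) l(1)])
  qed (use l in simp)
qed

lemma
  assumes "det M \<noteq> 0" "c \<in> half_lattice" "digit_enum M s" "k < index_det M"
  shows partner_less: "partner M c s k < index_det M"
    and digit_shift_partner: "digit_shift M c s k + digit_shift M c s (partner M c s k) \<in> int_lattice"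
    and partner_partner: "partner M c s (partner M c s k) = k"
proof -
  let ?P = "\<lambda>k l. l < index_det M \<and>
    mapply_inv M (2 *\<^sub>R c - of_int_vec (s k) - of_int_vec (s l)) \<in> int_lattice"
  have p: "?P k (partner M c s k)"
    unfolding partner_def by (rule theI'[OF partner_unique[OF assms]])
  then show less: "partner M c s k < index_det M" by simp
  have "digit_shift M c s k + digit_shift M c s (partner M c s k)
      = mapply_inv M (2 *\<^sub>R c - of_int_vec (s k) - of_int_vec (s (partner M c s k)))"
    by (simp add: digit_shift_def mapply_inv_add [symmetric] scaleR_2 algebra_simps)
  with p show "digit_shift M c s k + digit_shift M c s (partner M c s k) \<in> int_lattice" by simp
  have "?P (partner M c s k) k" using p assms(4) by (simp add: algebra_simps)
  then show "partner M c s (partner M c s k) = k"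
    unfolding partner_def[of M c s "partner M c s k"]
    by (rule the1_equality[OF partner_unique[OF assms(1-3) less]])
qed

text \<open>
The frequencies, in the variable \<open>M\<^sup>* \<xi>\<close> and after division by \<open>wave c\<close>, of the part of a
trigonometric polynomial that comes from the coset of \<open>s k\<close>.
\<close>

definition digit_coset ::
  "int ^ 'd ^ 'd::finite \<Rightarrow> real ^ 'd \<Rightarrow> (nat \<Rightarrow> int ^ 'd) \<Rightarrow> nat \<Rightarrow> (real ^ 'd) set" where
  "digit_coset M c s k = (\<lambda>x. x - digit_shift M c s k) ` int_lattice"

lemma mem_digit_coset: "a \<in> digit_coset M c s k \<longleftrightarrow> a + digit_shift M c s k \<in> int_lattice"
  unfolding digit_coset_def by (auto simp: image_iff algebra_simps)

lemma uminus_digit_coset: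
  assumes "det M \<noteq> 0" "c \<in> half_lattice" "digit_enum M s" "k < index_det M"
    and a: "a \<in> digit_coset M c s k"
  shows "- a \<in> digit_coset M c s (partner M c s k)"
  using int_lattice_diff[OF digit_shift_partner[OF assms(1-4)] a[unfolded mem_digit_coset]]
  by (simp add: mem_digit_coset)

lemma
  assumes "det M \<noteq> 0" "c \<in> half_lattice" "digit_enum M s" "j \<in> J_set M c s"
  shows sigma_of_half: "sigma_of M c s j \<in> half_lattice"
    and sigma_of_bounds: "0 \<le> sigma_of M c s j $ r" "sigma_of M c s j $ r \<le> 1/2"
    and sigma_of_coset: "(+) (sigma_of M c s j) ` int_lattice = digit_coset M c s j"
proof -
  let ?d = "digit_shift M c s j"
  have "j < index_det M" "partner M c s j = j" using assms(4) by (simp_all add: J_set_def)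
  then have d: "?d + ?d \<in> int_lattice"
    using digit_shift_partner[OF assms(1-3), of j] by simp
  have sig: "sigma_of M c s j $ i = ?d $ i - of_int \<lfloor>?d $ i\<rfloor>" for i
    by (simp add: sigma_of_def frac_def)
  have ints: "2 * ?d $ i \<in> \<int>" for i using d by (simp add: int_lattice_iff)
  have ints': "2 * sigma_of M c s j $ i \<in> \<int>" for i
    using Ints_diff[OF ints[of i], of "2 * of_int \<lfloor>?d $ i\<rfloor>"] by (simp add: sig algebra_simps)
  then show "sigma_of M c s j \<in> half_lattice"
    by (simp add: half_lattice_def int_lattice_iff)
  show "0 \<le> sigma_of M c s j $ r" by (simp add: sigma_of_def)
  show "sigma_of M c s j $ r \<le> 1/2"
  proof -
    obtain z :: int where z: "2 * sigma_of M c s j $ r = of_int z" using ints'[of r] by (auto elim: Ints_cases)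
    have "sigma_of M c s j $ r < 1" by (simp add: sigma_of_def frac_lt_1)
    then have "z < 2" using z by linarith
    then have "z \<le> 1" by simp
    then show ?thesis using z by linarith
  qed
  \<comment> \<open>As \<open>2d\<close> is integral, both \<open>\<sigma> = d - \<lfloor>d\<rfloor>\<close> and \<open>- d\<close> represent the same class.\<close>
  have "x - sigma_of M c s j \<in> int_lattice \<longleftrightarrow> x + ?d \<in> int_lattice" for x
  proof -
    have eq: "x + ?d = (x - sigma_of M c s j) + (sigma_of M c s j + ?d)" by simp
    have "sigma_of M c s j $ i + ?d $ i \<in> \<int>" for i
      using Ints_diff[OF ints[of i], of "of_int \<lfloor>?d $ i\<rfloor>"] by (simp add: sig algebra_simps)
    then have "sigma_of M c s j + ?d \<in> int_lattice" by (simp add: int_lattice_iff)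
    then show ?thesis
      using int_lattice_add[of "x - sigma_of M c s j" "sigma_of M c s j + ?d"]
        int_lattice_diff[of "x + ?d" "sigma_of M c s j + ?d"] by (auto simp: algebra_simps)
  qed
  moreover have "x \<in> (+) (sigma_of M c s j) ` int_lattice \<longleftrightarrow> x - sigma_of M c s j \<in> int_lattice" for x
    by (auto simp: image_iff algebra_simps intro!: bexI[of _ "x - sigma_of M c s j"])
  ultimately show "(+) (sigma_of M c s j) ` int_lattice = digit_coset M c s j"
    by (intro set_eqI) (simp only: mem_digit_coset)
qed

section \<open>Polyphase components of a mask\<close>

lemma same_moments_iff_flat:
  assumes "exp_poly L f" "exp_poly L' g"
  shows "(\<forall>\<beta> \<in> Delta n. moment \<beta> f = moment \<beta> g) \<longleftrightarrow> flat n (\<lambda>\<xi>. f \<xi> - g \<xi>)"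
  by (auto simp: flat_def moment_diff[OF assms] Delta_def)

lemma flat_wave_times_iff:
  assumes "exp_poly L f" shows "flat n (\<lambda>\<xi>. wave b \<xi> * f \<xi>) \<longleftrightarrow> flat n f"
proof
  have "exp_poly UNIV (\<lambda>\<xi>. wave b \<xi> * f \<xi>)" by (rule exp_poly_wave_times[OF assms]) simp
  moreover assume "flat n (\<lambda>\<xi>. wave b \<xi> * f \<xi>)"
  ultimately have "flat n (\<lambda>\<xi>. wave (- b) \<xi> * (wave b \<xi> * f \<xi>))" by (rule flat_wave_times)
  then show "flat n f" by (simp add: wave_uminus)
qed (rule flat_wave_times[OF assms])

lemma same_moments_wave_times:
  assumes "exp_poly L f" "exp_poly L' g"
  shows "(\<forall>\<beta> \<in> Delta n. moment \<beta> (\<lambda>\<xi>. wave b \<xi> * f \<xi>) = moment \<beta> (\<lambda>\<xi>. wave b \<xi> * g \<xi>))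
    \<longleftrightarrow> (\<forall>\<beta> \<in> Delta n. moment \<beta> f = moment \<beta> g)"
proof -
  have "exp_poly UNIV (\<lambda>\<xi>. wave b \<xi> * f \<xi>)" "exp_poly UNIV (\<lambda>\<xi>. wave b \<xi> * g \<xi>)"
    by (rule exp_poly_wave_times[OF assms(1)] exp_poly_wave_times[OF assms(2)], simp)+
  moreover have "exp_poly UNIV (\<lambda>\<xi>. f \<xi> - g \<xi>)"
    using assms by (intro exp_poly_diff) (auto intro: exp_poly_UNIV)
  ultimately show ?thesis
    by (simp add: same_moments_iff_flat[OF assms] same_moments_iff_flat[where L = UNIV and L' = UNIV]
        flat_wave_times_iff flip: right_diff_distrib)
qed

lemma exp_poly_mapply:
  assumes "exp_poly L f" "\<And>a. a \<in> L \<Longrightarrow> mapply M a \<in> L'"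
  shows "exp_poly L' (\<lambda>\<xi>. f (mapply (transpose M) \<xi>))"
  using assms
proof (induction rule: exp_poly.induct)
  case (exp_poly_step a f z)
  then have "exp_poly L' (\<lambda>\<xi>. z * wave (mapply M a) \<xi> + f (mapply (transpose M) \<xi>))"
    by (intro exp_poly.intros) auto
  then show ?case by (simp add: wave_mapply)
qed simp

text \<open>
If all frequencies agree modulo the integer lattice, translation by a lattice vector multiplies
the whole sum by one and the same root of unity.
\<close>

lemma exp_poly_coset_translate:
  assumes "exp_poly L f" and L: "\<And>a. a \<in> L \<Longrightarrow> a - b \<in> int_lattice" and x: "x \<in> int_lattice"
  shows "f (x + \<eta>) = wave b x * f \<eta>"
  using assms(1)
proof (induction rule: exp_poly.induct)
  case (exp_poly_step a f z)
  have "wave a x = wave (a - b) x * wave b x" by (simp flip: wave_add)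
  also have "\<dots> = wave b x" using L[OF exp_poly_step.hyps(1)] x by (simp add: wave_int_int)
  finally show ?case by (simp add: exp_poly_step.IH wave_add_right ring_distribs mult_ac)
qed simp

lemma wave_double_cancel: "wave (2 *\<^sub>R c) \<xi> * (wave c (- \<xi>) * z) = wave c \<xi> * z"
  unfolding scaleR_2 wave_add by (simp add: mult.assoc)

locale symmetric_digits =
  fixes M :: "int ^ 'd ^ 'd::finite" and c :: "real ^ 'd" and s :: "nat \<Rightarrow> int ^ 'd"
    and Dt :: "(int ^ 'd) set"
  assumes det: "det M \<noteq> 0" and c_half: "c \<in> half_lattice" and digits: "digit_enum M s"
    and dual: "digit_set (transpose M) Dt" "0 \<in> Dt"
begin

abbreviation "m \<equiv> index_det M"
abbreviation "mirror \<equiv> partner M c s"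
abbreviation "shift \<equiv> digit_shift M c s"
abbreviation "coset \<equiv> digit_coset M c s"

lemma m_pos: "m > 0"
  using det by (simp add: index_det_def)

lemma mapply_shift: "mapply M (shift k) = c - of_int_vec (s k)"
  by (simp add: digit_shift_def mapply_mapply_inv[OF det])

definition polyphase :: "(nat \<Rightarrow> real ^ 'd \<Rightarrow> complex) \<Rightarrow> real ^ 'd \<Rightarrow> complex" where
  "polyphase q \<xi> = wave c \<xi> * (\<Sum>k<m. q k (mapply (transpose M) \<xi>))"

lemma exp_poly_polyphase:
  assumes "\<And>k. k < m \<Longrightarrow> exp_poly (coset k) (q k)"
  shows "exp_poly int_lattice (polyphase q)"
proof -
  have "exp_poly int_lattice (\<lambda>\<xi>. \<Sum>k<m. wave c \<xi> * q k (mapply (transpose M) \<xi>))"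
  proof (intro exp_poly_sum exp_poly_wave_times[OF exp_poly_mapply])
    fix k a assume "k \<in> {..<m}"
    then show "exp_poly (coset k) (q k)" using assms by simp
    show "mapply M a \<in> mapply M ` coset k" if "a \<in> coset k" using that by simp
  next
    fix k a assume "k \<in> {..<m}" "a \<in> mapply M ` coset k"
    then obtain x where x: "x \<in> int_lattice" "a = mapply M (x - shift k)"
      by (auto simp: digit_coset_def)
    then have "c + a = of_int_vec (s k) + mapply M x"
      by (simp add: mapply_diff mapply_shift)
    then show "c + a \<in> int_lattice"
      using x by (auto intro: int_lattice_add mapply_int_lattice)
  qed
  then show ?thesis by (simp add: polyphase_def[abs_def] sum_distrib_left)
qed

text \<open>
Wave by wave: the frequency \<open>x\<close> is \<open>s k + M y\<close> for exactly one digit, and \<open>wave x\<close> contributes to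
the component \<open>k\<close>.
\<close>

lemma polyphase_exists:
  assumes "exp_poly int_lattice f"
  shows "\<exists>q. (\<forall>k. exp_poly (coset k) (q k)) \<and> f = polyphase q"
  using assms
proof (induction rule: exp_poly.induct)
  case exp_poly_0
  show ?case by (rule exI[of _ "\<lambda>_ _. 0"]) (simp add: polyphase_def[abs_def])
next
  case (exp_poly_step a f z)
  then obtain q where q: "\<And>k. exp_poly (coset k) (q k)" and f: "f = polyphase q" by blast
  obtain x where x: "a = of_int_vec x" using exp_poly_step.hyps by (auto simp: int_lattice_def)
  have "\<exists>!t. t \<in> s ` {..<m} \<and> (\<exists>y. x - t = M *v y)"
    using digits by (simp add: digit_enum_def digit_set_def)
  then obtain k y where k: "k < m" and y: "x - s k = M *v y" by blast
  define b where "b = of_int_vec y - shift k"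
  have "b \<in> coset k" by (simp add: b_def mem_digit_coset)
  then have "exp_poly (coset l) (\<lambda>\<eta>. (if l = k then z * wave b \<eta> else 0) + q l \<eta>)" for l
    using q by (cases "l = k") (auto intro: exp_poly.intros)
  moreover have "z * wave a \<xi> + f \<xi>
      = polyphase (\<lambda>l \<eta>. (if l = k then z * wave b \<eta> else 0) + q l \<eta>) \<xi>" for \<xi>
  proof -
    have "c + mapply M b = of_int_vec (s k + M *v y)"
      by (simp add: b_def mapply_diff mapply_shift mapply_of_int_vec of_int_vec_add)
    then have "c + mapply M b = a" by (simp add: x flip: y)
    then have "wave a \<xi> = wave c \<xi> * wave b (mapply (transpose M) \<xi>)"
      by (metis wave_add wave_mapply)
    then show ?thesis
      using k by (simp add: f polyphase_def sum.distrib algebra_simps)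
  qed
  ultimately show ?case
    by (intro exI[of _ "\<lambda>l \<eta>. (if l = k then z * wave b \<eta> else 0) + q l \<eta>"])
      (simp add: fun_eq_iff)
qed

text \<open>
The component \<open>k\<close> acquires the factor \<open>wave (- M\<^sup>-\<^sup>1 (c - s\<^sub>k)) x\<close>, and the common factor
\<open>wave c\<close> contributes \<open>wave (M\<^sup>-\<^sup>1 c) x\<close>; together they give the character belonging to \<open>s k\<close>.
\<close>

lemma polyphase_translate:
  assumes q: "\<And>k. k < m \<Longrightarrow> exp_poly (coset k) (q k)"
  shows "polyphase q (mapply_inv (transpose M) (of_int_vec x + \<eta>))
    = (\<Sum>k<m. wave (mapply_inv M (of_int_vec (s k))) (of_int_vec x)
        * (wave (mapply_inv M c) \<eta> * q k \<eta>))"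
proof -
  have det': "det (transpose M) \<noteq> 0" using det by (simp add: det_transpose_int)
  let ?x = "of_int_vec x"
  have "polyphase q (mapply_inv (transpose M) (?x + \<eta>))
      = (\<Sum>k<m. wave (mapply_inv M c) (?x + \<eta>) * q k (?x + \<eta>))"
    by (simp add: polyphase_def mapply_mapply_inv[OF det'] wave_mapply_inv[OF det] sum_distrib_left)
  also have "\<dots> = (\<Sum>k<m. wave (mapply_inv M (of_int_vec (s k))) ?x * (wave (mapply_inv M c) \<eta> * q k \<eta>))"
  proof (intro sum.cong refl)
    fix k assume "k \<in> {..<m}"
    then have "q k (?x + \<eta>) = wave (- shift k) ?x * q k \<eta>"
      by (intro exp_poly_coset_translate[OF q]) (auto simp: mem_digit_coset)
    moreover have "wave (mapply_inv M (of_int_vec (s k))) ?x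
        = wave (mapply_inv M c) ?x * wave (- shift k) ?x"
      by (simp add: digit_shift_def mapply_inv_diff flip: wave_add)
    ultimately show "wave (mapply_inv M c) (?x + \<eta>) * q k (?x + \<eta>)
        = wave (mapply_inv M (of_int_vec (s k))) ?x * (wave (mapply_inv M c) \<eta> * q k \<eta>)"
      by (simp add: wave_add_right)
  qed
  finally show ?thesis .
qed

text \<open>
By \<open>polyphase_translate\<close>, the sum rule says that the vector of the moments of the components is
orthogonal to the characters \<open>k \<mapsto> wave (M\<^sup>-\<^sup>1 s\<^sub>k) x\<close> with a nonzero dual digit \<open>x\<close>. Only the
constant vectors are orthogonal to all of these. The common factor \<open>wave c\<close> may be dropped, as multiplication by a wave transforms
the moments of all components in the same way.
\<close>

lemma sum_rule_polyphase_iff: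
  assumes q: "\<And>k. k < m \<Longrightarrow> exp_poly (coset k) (q k)"
  shows "sum_rule M Dt n (polyphase q) \<longleftrightarrow>
    (\<forall>k<m. \<forall>\<beta> \<in> Delta n. moment \<beta> (q k) = moment \<beta> (q 0))"
proof -
  define g where "g k = (\<lambda>\<eta>. wave (mapply_inv M c) \<eta> * q k \<eta>)" for k
  have g: "exp_poly UNIV (g k)" if "k < m" for k
    unfolding g_def by (rule exp_poly_wave_times[OF q[OF that]]) simp
  define u where "u k = mapply_inv M (of_int_vec (s k))" for k
  have translate: "polyphase q (mapply_inv (transpose M) (of_int_vec x + \<eta>))
      = (\<Sum>k<m. wave (u k) (of_int_vec x) * g k \<eta>)" for x \<eta>
    unfolding g_def u_def by (rule polyphase_translate[OF q])
  have "exp_poly UNIV (\<lambda>\<xi>. polyphase q (mapply_inv (transpose M) (of_int_vec 0 + \<xi>)))"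
    unfolding translate by (intro exp_poly_sum exp_poly_scale g) simp
  then have "exp_poly UNIV (\<lambda>\<xi>. polyphase q (mapply_inv (transpose M) \<xi>))" by simp
  note mderiv_eq = mderiv_eq_moment_translate[OF this]
  have deriv: "mderiv \<beta> (\<lambda>\<xi>. polyphase q (mapply_inv (transpose M) \<xi>)) (of_int_vec x)
      = (2 * complex_of_real pi * \<i>) ^ msize \<beta> * (\<Sum>k<m. wave (u k) (of_int_vec x) * moment \<beta> (g k))"
    for \<beta> x
    unfolding mderiv_eq translate
    by (subst moment_sum[where L = UNIV]) (auto intro: exp_poly_scale g simp: moment_scale[OF g])
  have rule: "sum_rule M Dt n (polyphase q) \<longleftrightarrow>
      (\<forall>x\<in>Dt - {0}. \<forall>\<beta>\<in>Delta n. (\<Sum>k<m. wave (u k) (of_int_vec x) * moment \<beta> (g k)) = 0)"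
    unfolding sum_rule_def deriv by simp
  have fin: "finite Dt"
    using digit_set_finite[OF _ dual(1)] det by (simp add: det_transpose_int)
  have card: "card Dt > 0" using fin dual(2) by (auto simp: card_gt_0_iff)
  have "sum_rule M Dt n (polyphase q) \<longleftrightarrow>
      (\<forall>k<m. \<forall>\<beta> \<in> Delta n. moment \<beta> (g k) = moment \<beta> (g 0))"
  proof
    assume sr: "sum_rule M Dt n (polyphase q)"
    have sum: "of_nat (card Dt) * moment \<beta> (g l) = (\<Sum>k<m. moment \<beta> (g k))"
      if l: "l < m" and \<beta>: "\<beta> \<in> Delta n" for l and \<beta> :: "nat ^ 'd"
    proof -
      have "of_nat (card Dt) * moment \<beta> (g l)
          = (\<Sum>x\<in>Dt. wave (- u l) (of_int_vec x) * (\<Sum>k<m. wave (u k) (of_int_vec x) * moment \<beta> (g k)))"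
        unfolding u_def by (rule polyphase_inversion[OF det digits dual(1) l, symmetric])
      \<comment> \<open>The sum rule annihilates all summands but the one with \<open>x = 0\<close>, which does not depend on \<open>l\<close>.\<close>
      also have "\<dots> = (\<Sum>x\<in>{0}. wave (- u l) (of_int_vec x) * (\<Sum>k<m. wave (u k) (of_int_vec x) * moment \<beta> (g k)))"
        by (rule sum.mono_neutral_right) (use fin dual(2) sr \<beta> in \<open>auto simp: rule\<close>)
      finally show ?thesis by simp
    qed
    show "\<forall>k<m. \<forall>\<beta> \<in> Delta n. moment \<beta> (g k) = moment \<beta> (g 0)"
    proof (intro allI impI ballI)
      fix k and \<beta> :: "nat ^ 'd" assume k: "k < m" "\<beta> \<in> Delta n"
      have "of_nat (card Dt) * moment \<beta> (g k) = of_nat (card Dt) * moment \<beta> (g 0)"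
        unfolding sum[OF k] sum[OF m_pos k(2)] ..
      moreover have "(of_nat (card Dt) :: complex) \<noteq> 0" using card by simp
      ultimately show "moment \<beta> (g k) = moment \<beta> (g 0)" by (simp only: mult_cancel_left) simp
    qed
  next
    assume eq: "\<forall>k<m. \<forall>\<beta> \<in> Delta n. moment \<beta> (g k) = moment \<beta> (g 0)"
    have "(\<Sum>k<m. wave (u k) (of_int_vec x) * moment \<beta> (g k)) = 0"
      if "x \<in> Dt - {0}" "\<beta> \<in> Delta n" for x \<beta>
    proof -
      have "(\<Sum>k<m. wave (u k) (of_int_vec x) * moment \<beta> (g k))
          = (\<Sum>k<m. wave (u k) (of_int_vec x)) * moment \<beta> (g 0)"
        unfolding sum_distrib_right
      proof (intro sum.cong refl)
        fix k assume "k \<in> {..<m}"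
        then have "moment \<beta> (g k) = moment \<beta> (g 0)" using eq that(2) by blast
        then show "wave (u k) (of_int_vec x) * moment \<beta> (g k)
            = wave (u k) (of_int_vec x) * moment \<beta> (g 0)" by (simp only:)
      qed
      then show ?thesis
        using digit_waves_cancel[OF det digits dual that(1)] by (simp add: u_def)
    qed
    then show "sum_rule M Dt n (polyphase q)" by (simp add: rule)
  qed
  also have "\<dots> \<longleftrightarrow> (\<forall>k<m. \<forall>\<beta> \<in> Delta n. moment \<beta> (q k) = moment \<beta> (q 0))"
    unfolding g_def using same_moments_wave_times[OF q q[OF m_pos]] by simp
  finally show ?thesis .
qed

lemma mirror_less: "k < m \<Longrightarrow> mirror k < m"
  and mirror_mirror: "k < m \<Longrightarrow> mirror (mirror k) = k"
  using partner_less[OF det c_half digits] partner_partner[OF det c_half digits] by blast+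

lemma sum_mirror: "(\<Sum>k<m. f (mirror k)) = (\<Sum>k<m. f k)"
  by (rule sum.reindex_bij_witness[of _ mirror mirror]) (auto simp: mirror_less mirror_mirror)

lemma exp_poly_coset_reflect:
  assumes "k < m" "exp_poly (coset k) f"
  shows "exp_poly (coset (mirror k)) (\<lambda>\<xi>. f (- \<xi>))"
  using assms(2) by (rule exp_poly_reflect) (rule uminus_digit_coset[OF det c_half digits assms(1)])

lemma symmetric_polyphase:
  assumes "\<And>k \<eta>. k < m \<Longrightarrow> q (mirror k) \<eta> = q k (- \<eta>)"
  shows "symmetric_about c (polyphase q)"
  unfolding symmetric_about_def
proof
  fix \<xi>
  have "(\<Sum>k<m. q k (- mapply (transpose M) \<xi>)) = (\<Sum>k<m. q k (mapply (transpose M) \<xi>))"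
    by (subst (2) sum_mirror[symmetric]) (simp add: assms)
  then show "polyphase q \<xi> = wave (2 *\<^sub>R c) \<xi> * polyphase q (- \<xi>)"
    by (simp add: polyphase_def mapply_uminus wave_double_cancel)
qed

text \<open>
Averaging an arbitrary decomposition with its mirror image gives a symmetric one, and
the average still represents \<open>f\<close> because \<open>f\<close> is symmetric.
\<close>

lemma symmetric_polyphase_exists:
  assumes f: "exp_poly int_lattice f" and sym: "symmetric_about c f"
  obtains q where "\<And>k. k < m \<Longrightarrow> exp_poly (coset k) (q k)"
    "\<And>k \<eta>. k < m \<Longrightarrow> q (mirror k) \<eta> = q k (- \<eta>)" "f = polyphase q"
proof -
  obtain q where q: "\<And>k. exp_poly (coset k) (q k)" and f: "f = polyphase q"
    using polyphase_exists[OF f] by blast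
  define r where "r k \<eta> = 1/2 * (q k \<eta> + q (mirror k) (- \<eta>))" for k \<eta>
  show ?thesis
  proof
    show "exp_poly (coset k) (r k)" if k: "k < m" for k
      unfolding r_def using exp_poly_coset_reflect[OF mirror_less[OF k] q] q k
      by (intro exp_poly_scale exp_poly_add) (auto simp: mirror_mirror)
    show "r (mirror k) \<eta> = r k (- \<eta>)" if "k < m" for k \<eta>
      using that by (simp add: r_def mirror_mirror)
    show "f = polyphase r"
    proof
      fix \<xi>
      have "f \<xi> = 1/2 * (f \<xi> + wave (2 *\<^sub>R c) \<xi> * f (- \<xi>))"
        unfolding sym[unfolded symmetric_about_def, rule_format, of \<xi>, symmetric] by simp
      also have "\<dots> = 1/2 * (wave c \<xi> * (\<Sum>k<m. q k (mapply (transpose M) \<xi>))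
          + wave c \<xi> * (\<Sum>k<m. q k (- mapply (transpose M) \<xi>)))"
        by (simp add: f polyphase_def mapply_uminus wave_double_cancel)
      also have "(\<Sum>k<m. q k (- mapply (transpose M) \<xi>)) = (\<Sum>k<m. q (mirror k) (- mapply (transpose M) \<xi>))"
        by (rule sum_mirror[symmetric])
      finally show "f \<xi> = polyphase r \<xi>"
        by (simp add: polyphase_def r_def sum_distrib_left sum.distrib distrib_left mult_ac)
    qed
  qed
qed

text \<open>
The number \<open>lam \<beta>\<close> is \<open>m\<close> times the common moment, i.e. the moment of the sum of all components,
which is \<open>m\<^sub>0\<close> divided by \<open>wave c\<close>; at \<open>\<beta> = 0\<close> this is the value of \<open>m\<^sub>0\<close> at the origin.
\<close>

theorem mask_iff_polyphase:
  assumes n: "n \<ge> 1"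
  shows "mask f \<and> symmetric_about c f \<and> sum_rule M Dt n f \<longleftrightarrow>
    (\<exists>q lam. lam 0 = 1 \<and> (\<forall>\<beta> \<in> Delta n. odd (msize \<beta>) \<longrightarrow> lam \<beta> = 0) \<and>
       (\<forall>k<m. exp_poly (coset k) (q k) \<and> (\<forall>\<eta>. q (mirror k) \<eta> = q k (- \<eta>)) \<and>
          (\<forall>\<beta> \<in> Delta n. moment \<beta> (q k) = lam \<beta> / of_nat m)) \<and>
       f = polyphase q)" (is "?lhs \<longleftrightarrow> ?rhs")
proof
  assume lhs: ?lhs
  then have "exp_poly int_lattice f" by (simp add: mask_def exp_poly_trig_poly)
  then obtain q where q: "\<And>k. k < m \<Longrightarrow> exp_poly (coset k) (q k)"
    and mirror: "\<And>k \<eta>. k < m \<Longrightarrow> q (mirror k) \<eta> = q k (- \<eta>)" and f: "f = polyphase q"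
    using lhs symmetric_polyphase_exists by blast
  have eq: "moment \<beta> (q k) = moment \<beta> (q 0)" if "k < m" "\<beta> \<in> Delta n" for k \<beta>
  proof -
    have "sum_rule M Dt n (polyphase q)" using lhs f by simp
    also have "sum_rule M Dt n (polyphase q) \<longleftrightarrow>
        (\<forall>k<m. \<forall>\<beta> \<in> Delta n. moment \<beta> (q k) = moment \<beta> (q 0))"
      by (rule sum_rule_polyphase_iff) (rule q)
    finally show ?thesis using that by blast
  qed
  define lam where "lam \<beta> = of_nat m * moment \<beta> (q 0)" for \<beta>
  have zero: "0 \<in> Delta n" using n by (simp add: Delta_def)
  have "(\<Sum>k<m. moment 0 (q k)) = (\<Sum>k<m. moment 0 (q 0))"
    by (intro sum.cong refl eq zero) simp
  then have "lam 0 = (\<Sum>k<m. moment 0 (q k))" by (simp add: lam_def)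
  also have "\<dots> = f 0" by (simp add: f polyphase_def moment_zero_multiindex)
  also have "\<dots> = 1" using lhs by (simp add: mask_def)
  finally have "lam 0 = 1" .
  moreover have "lam \<beta> = 0" if \<beta>: "\<beta> \<in> Delta n" "odd (msize \<beta>)" for \<beta>
  proof -
    have "moment \<beta> (q 0) = moment \<beta> (q (mirror 0))"
      using eq[OF mirror_less[OF m_pos] \<beta>(1)] by simp
    also have "q (mirror 0) = (\<lambda>\<eta>. q 0 (- \<eta>))" using mirror[OF m_pos] by (simp add: fun_eq_iff)
    also have "moment \<beta> \<dots> = - moment \<beta> (q 0)"
      using \<beta> by (simp add: moment_reflect[OF q[OF m_pos]])
    finally show ?thesis by (simp add: lam_def)
  qed
  moreover have "moment \<beta> (q k) = lam \<beta> / of_nat m" if "k < m" "\<beta> \<in> Delta n" for k \<beta>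
    using that m_pos eq[OF that] by (simp add: lam_def)
  ultimately show ?rhs using q mirror f by blast
next
  assume ?rhs
  then obtain q lam where lam: "lam 0 = 1"
    and q: "\<And>k. k < m \<Longrightarrow> exp_poly (coset k) (q k)"
    and mirror: "\<And>k \<eta>. k < m \<Longrightarrow> q (mirror k) \<eta> = q k (- \<eta>)"
    and mom: "\<And>k \<beta>. k < m \<Longrightarrow> \<beta> \<in> Delta n \<Longrightarrow> moment \<beta> (q k) = lam \<beta> / of_nat m"
    and f: "f = polyphase q" by blast
  have zero: "0 \<in> Delta n" using n by (simp add: Delta_def)
  have "q k 0 = 1 / of_nat m" if "k < m" for k
    using mom[OF that zero] lam by (simp add: moment_zero_multiindex)
  then have "f 0 = 1" using m_pos by (simp add: f polyphase_def)
  moreover have "trig_poly f"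
    unfolding exp_poly_trig_poly f using q by (rule exp_poly_polyphase)
  moreover have "sum_rule M Dt n f"
    unfolding f using mom m_pos by (subst sum_rule_polyphase_iff) (simp_all add: q)
  moreover have "symmetric_about c f"
    unfolding f by (rule symmetric_polyphase) (rule mirror)
  ultimately show ?lhs by (simp add: mask_def)
qed

end

section \<open>Exponential sums with prescribed moments\<close>

lemma Delta_downward: "\<beta> \<in> Delta n \<Longrightarrow> \<gamma> \<le> \<beta> \<Longrightarrow> \<gamma> \<in> Delta n"
  using msize_mono by (fastforce simp: Delta_def)

text \<open>
The subset \<open>S\<close> allows for families that are dual to the moments only at even multi-indices, as
for the even polynomials \<open>G\<^sup>A\<close>.
\<close>

lemma moment_interpolation:
  fixes g :: "nat ^ 'd::finite \<Rightarrow> real ^ 'd \<Rightarrow> complex"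
  assumes S: "S \<subseteq> Delta n" and \<mu>: "\<And>\<beta>. \<beta> \<in> Delta n - S \<Longrightarrow> \<mu> \<beta> = 0"
    and g: "\<And>\<beta>. \<beta> \<in> S \<Longrightarrow> exp_poly L (g \<beta>)"
    and dual: "\<And>\<alpha> \<beta>. \<alpha> \<in> Delta n \<Longrightarrow> \<beta> \<in> S \<Longrightarrow> moment \<alpha> (g \<beta>) = (if \<alpha> = \<beta> then 1 else 0)"
  shows "exp_poly L (\<lambda>\<xi>. \<Sum>\<beta>\<in>Delta n. \<mu> \<beta> * g \<beta> \<xi>)" (is "exp_poly L ?h")
    and "\<alpha> \<in> Delta n \<Longrightarrow> moment \<alpha> (\<lambda>\<xi>. \<Sum>\<beta>\<in>Delta n. \<mu> \<beta> * g \<beta> \<xi>) = \<mu> \<alpha>"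
proof -
  have finS: "finite S" using S by (rule finite_subset) simp
  have h: "?h = (\<lambda>\<xi>. \<Sum>\<beta>\<in>S. \<mu> \<beta> * g \<beta> \<xi>)"
    by (rule ext, rule sum.mono_neutral_right) (use S \<mu> in auto)
  show "exp_poly L ?h"
    unfolding h by (intro exp_poly_sum exp_poly_scale g)
  assume \<alpha>: "\<alpha> \<in> Delta n"
  have "moment \<alpha> ?h = (\<Sum>\<beta>\<in>S. \<mu> \<beta> * moment \<alpha> (g \<beta>))"
    unfolding h by (subst moment_sum[where L = L]) (auto intro: exp_poly_scale g simp: moment_scale[OF g])
  also have "\<dots> = (\<Sum>\<beta>\<in>S. if \<beta> = \<alpha> then \<mu> \<beta> else 0)"
    by (rule sum.cong) (use \<alpha> dual in auto)
  also have "\<dots> = \<mu> \<alpha>" using \<alpha> \<mu> finS by auto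
  finally show "moment \<alpha> ?h = \<mu> \<alpha>" .
qed

text \<open>
The binomial transforms for \<open>b\<close> and \<open>- b\<close> are inverse to each other. Instead of computing with
the coefficients, compare \<open>f\<close> with a sum \<open>h\<close> that has the moments \<open>\<nu>\<close>: both conditions say that
\<open>f - h\<close> vanishes to order \<open>n\<close>, before or after multiplication by \<open>wave b\<close>.
\<close>

lemma moments_wave_times_iff:
  fixes g :: "nat ^ 'd::finite \<Rightarrow> real ^ 'd \<Rightarrow> complex" and f :: "real ^ 'd \<Rightarrow> complex"
  assumes f: "exp_poly L f"
    and g: "\<And>\<beta>. \<beta> \<in> Delta n \<Longrightarrow> exp_poly L' (g \<beta>)"
    and dual: "\<And>\<alpha> \<beta>. \<alpha> \<in> Delta n \<Longrightarrow> \<beta> \<in> Delta n \<Longrightarrow> moment \<alpha> (g \<beta>) = (if \<alpha> = \<beta> then 1 else 0)"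
  shows "(\<forall>\<beta> \<in> Delta n. moment \<beta> (\<lambda>\<xi>. wave b \<xi> * f \<xi>) = binomial_transform b \<nu> \<beta>)
    \<longleftrightarrow> (\<forall>\<beta> \<in> Delta n. moment \<beta> f = \<nu> \<beta>)"
proof -
  define h where "h = (\<lambda>\<xi>. \<Sum>\<beta>\<in>Delta n. \<nu> \<beta> * g \<beta> \<xi>)"
  have h: "exp_poly L' h"
    unfolding h_def by (rule moment_interpolation(1)[where S = "Delta n"]) (auto intro: g simp: dual)
  have mom: "moment \<beta> h = \<nu> \<beta>" if "\<beta> \<in> Delta n" for \<beta>
    unfolding h_def
    by (rule moment_interpolation(2)[where S = "Delta n" and L = L']) (auto intro: g that simp: dual)
  have "moment \<beta> (\<lambda>\<xi>. wave b \<xi> * h \<xi>) = binomial_transform b \<nu> \<beta>" if "\<beta> \<in> Delta n" for \<beta>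
    unfolding moment_wave_times[OF h] binomial_transform_def
    by (intro sum.cong refl) (use that in \<open>auto simp: mom Delta_downward\<close>)
  then show ?thesis
    using same_moments_wave_times[OF f h, of n b] mom by auto
qed

lemma Theta_moment:
  assumes "t \<in> Theta \<beta> n" "\<alpha> \<in> Delta n"
  shows "moment \<alpha> t = (if \<alpha> = \<beta> then 1 else 0)"
  using assms by (simp add: Theta_def moment_def)

section \<open>Even exponential sums vanishing to high order\<close>

lemma Re_Pi_poly: "complex_of_real (Re (Pi_poly \<alpha> \<xi>)) = (Pi_poly \<alpha> \<xi> + Pi_poly \<alpha> (- \<xi>)) / 2"
  by (simp add: Pi_poly_uminus complex_add_cnj)

lemma Im_Pi_poly: "\<i> * complex_of_real (Im (Pi_poly \<alpha> \<xi>)) = (Pi_poly \<alpha> \<xi> - Pi_poly \<alpha> (- \<xi>)) / 2"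
  by (simp add: Pi_poly_uminus complex_diff_cnj)

text \<open>
The contribution of one self-paired digit to the homogeneous part of the general form.
\<close>

definition even_tail ::
  "nat \<Rightarrow> (nat ^ 'd::finite \<Rightarrow> real ^ 'd \<Rightarrow> complex) \<Rightarrow> (nat ^ 'd \<Rightarrow> real ^ 'd \<Rightarrow> complex) \<Rightarrow>
    real ^ 'd \<Rightarrow> complex" where
  "even_tail n A B \<xi> = (\<Sum>\<alpha> | msize \<alpha> = n.
     A \<alpha> \<xi> * complex_of_real (Re (Pi_poly \<alpha> \<xi>)) + \<i> * B \<alpha> \<xi> * complex_of_real (Im (Pi_poly \<alpha> \<xi>)))"

lemma even_tail_alt:
  "even_tail n A B \<xi> = (\<Sum>\<alpha> | msize \<alpha> = n.
     1/2 * ((A \<alpha> \<xi> + B \<alpha> \<xi>) * Pi_poly \<alpha> \<xi> + (A \<alpha> \<xi> - B \<alpha> \<xi>) * Pi_poly \<alpha> (- \<xi>)))"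
  unfolding even_tail_def
proof (intro sum.cong refl)
  fix \<alpha>
  have eq: "\<i> * B \<alpha> \<xi> * complex_of_real (Im (Pi_poly \<alpha> \<xi>)) = B \<alpha> \<xi> * (\<i> * complex_of_real (Im (Pi_poly \<alpha> \<xi>)))"
    by simp
  show "A \<alpha> \<xi> * complex_of_real (Re (Pi_poly \<alpha> \<xi>)) + \<i> * B \<alpha> \<xi> * complex_of_real (Im (Pi_poly \<alpha> \<xi>))
      = 1/2 * ((A \<alpha> \<xi> + B \<alpha> \<xi>) * Pi_poly \<alpha> \<xi> + (A \<alpha> \<xi> - B \<alpha> \<xi>) * Pi_poly \<alpha> (- \<xi>))"
    unfolding eq Re_Pi_poly Im_Pi_poly by (simp add: field_simps)
qed

lemma even_tail_uminus:
  assumes "\<And>\<alpha>. msize \<alpha> = n \<Longrightarrow> A \<alpha> (- \<xi>) = A \<alpha> \<xi>" "\<And>\<alpha>. msize \<alpha> = n \<Longrightarrow> B \<alpha> (- \<xi>) = - B \<alpha> \<xi>"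
  shows "even_tail n A B (- \<xi>) = even_tail n A B \<xi>"
  unfolding even_tail_def using assms by (intro sum.cong) (auto simp: Pi_poly_uminus)

lemma
  assumes L: "L = (+) \<sigma> ` int_lattice"
    and A: "\<And>\<alpha>. msize \<alpha> = n \<Longrightarrow> exp_poly L (A \<alpha>)" and B: "\<And>\<alpha>. msize \<alpha> = n \<Longrightarrow> exp_poly L (B \<alpha>)"
  shows exp_poly_even_tail: "exp_poly L (even_tail n A B)"
    and flat_even_tail: "flat n (even_tail n A B)"
proof -
  have L_add: "a + b \<in> L" if "a \<in> L" "b \<in> int_lattice" for a b
    using that by (auto simp: L add.assoc intro: int_lattice_add)
  have refl: "exp_poly int_lattice (\<lambda>\<xi>. Pi_poly \<alpha> (- \<xi>))" for \<alpha> :: "nat ^ 'a"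
    by (rule exp_poly_reflect[OF exp_poly_Pi_poly]) (simp add: int_lattice_uminus)
  have "exp_poly L (\<lambda>\<xi>. (A \<alpha> \<xi> + B \<alpha> \<xi>) * Pi_poly \<alpha> \<xi>) \<and> flat n (\<lambda>\<xi>. (A \<alpha> \<xi> + B \<alpha> \<xi>) * Pi_poly \<alpha> \<xi>) \<and>
     exp_poly L (\<lambda>\<xi>. (A \<alpha> \<xi> - B \<alpha> \<xi>) * Pi_poly \<alpha> (- \<xi>)) \<and> flat n (\<lambda>\<xi>. (A \<alpha> \<xi> - B \<alpha> \<xi>) * Pi_poly \<alpha> (- \<xi>))"
    if \<alpha>: "msize \<alpha> = n" for \<alpha>
  proof (intro conjI)
    note plus = exp_poly_add[OF A[OF \<alpha>] B[OF \<alpha>]] and minus = exp_poly_diff[OF A[OF \<alpha>] B[OF \<alpha>]]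
    have flat: "flat n (Pi_poly \<alpha>)" using moment_Pi_poly[OF \<alpha>] by blast
    show "exp_poly L (\<lambda>\<xi>. (A \<alpha> \<xi> + B \<alpha> \<xi>) * Pi_poly \<alpha> \<xi>)"
      by (rule exp_poly_mult[OF plus exp_poly_Pi_poly]) (rule L_add)
    show "exp_poly L (\<lambda>\<xi>. (A \<alpha> \<xi> - B \<alpha> \<xi>) * Pi_poly \<alpha> (- \<xi>))"
      by (rule exp_poly_mult[OF minus refl]) (rule L_add)
    show "flat n (\<lambda>\<xi>. (A \<alpha> \<xi> + B \<alpha> \<xi>) * Pi_poly \<alpha> \<xi>)"
      by (rule flat_mult[OF plus exp_poly_Pi_poly flat])
    show "flat n (\<lambda>\<xi>. (A \<alpha> \<xi> - B \<alpha> \<xi>) * Pi_poly \<alpha> (- \<xi>))"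
      by (rule flat_mult[OF minus refl flat_reflect[OF exp_poly_Pi_poly flat]])
  qed
  note parts = this[THEN conjunct1] this[THEN conjunct2, THEN conjunct1]
    this[THEN conjunct2, THEN conjunct2, THEN conjunct1] this[THEN conjunct2, THEN conjunct2, THEN conjunct2]
  show "exp_poly L (even_tail n A B)"
    unfolding even_tail_alt[abs_def] by (intro exp_poly_sum exp_poly_scale exp_poly_add parts) simp_all
  show "flat n (even_tail n A B)"
    unfolding even_tail_alt[abs_def]
    by (intro flat_sum[where L = L] exp_poly_scale flat_scale[where L = L]
        exp_poly_add flat_add[where L = L and L' = L] parts) simp_all
qed

text \<open>
Dividing by \<open>wave \<sigma>\<close> makes the frequencies integral, so \<open>f\<close> is a combination of the \<open>Pi_poly \<alpha>\<close>
with coefficients \<open>S \<alpha>\<close>. Since \<open>f\<close> is even, it equals the average of this combination and its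
reflection; as \<open>Pi_poly \<alpha> (- \<xi>)\<close> is the complex conjugate of \<open>Pi_poly \<alpha> \<xi>\<close>, the even part of \<open>S \<alpha>\<close>
is paired with the real part and the odd part with the imaginary part of \<open>Pi_poly \<alpha>\<close>.
\<close>

lemma even_flat_imp_even_tail:
  assumes L: "L = (+) \<sigma> ` int_lattice" and sym: "\<And>a. a \<in> L \<Longrightarrow> - a \<in> L"
    and f: "exp_poly L f" and even: "\<And>\<xi>. f (- \<xi>) = f \<xi>" and flat: "flat n f"
  shows "\<exists>A B. (\<forall>\<alpha>. exp_poly L (A \<alpha>) \<and> (\<forall>\<xi>. A \<alpha> (- \<xi>) = A \<alpha> \<xi>) \<and>
      exp_poly L (B \<alpha>) \<and> (\<forall>\<xi>. B \<alpha> (- \<xi>) = - B \<alpha> \<xi>)) \<and> f = even_tail n A B"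
proof -
  have "exp_poly int_lattice (\<lambda>\<xi>. wave (- \<sigma>) \<xi> * f \<xi>)"
    by (rule exp_poly_wave_times[OF f]) (auto simp: L)
  then have "Pi_span n (\<lambda>\<xi>. wave (- \<sigma>) \<xi> * f \<xi>)"
    using flat_wave_times[OF f flat] by (rule flat_imp_Pi_span)
  then obtain T where T: "\<And>\<alpha>. exp_poly int_lattice (T \<alpha>)"
    and eq: "(\<lambda>\<xi>. wave (- \<sigma>) \<xi> * f \<xi>) = (\<lambda>\<xi>. \<Sum>\<alpha> | msize \<alpha> = n. T \<alpha> \<xi> * Pi_poly \<alpha> \<xi>)"
    unfolding Pi_span_def by blast
  define S where "S \<alpha> \<xi> = wave \<sigma> \<xi> * T \<alpha> \<xi>" for \<alpha> \<xi>
  have S: "exp_poly L (S \<alpha>)" for \<alpha>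
    unfolding S_def by (rule exp_poly_wave_times[OF T]) (simp add: L)
  have f_eq: "f \<xi> = (\<Sum>\<alpha> | msize \<alpha> = n. S \<alpha> \<xi> * Pi_poly \<alpha> \<xi>)" for \<xi>
  proof -
    have "f \<xi> = wave \<sigma> \<xi> * (wave (- \<sigma>) \<xi> * f \<xi>)" by (simp add: wave_uminus)
    also have "\<dots> = wave \<sigma> \<xi> * (\<Sum>\<alpha> | msize \<alpha> = n. T \<alpha> \<xi> * Pi_poly \<alpha> \<xi>)"
      using fun_cong[OF eq, of \<xi>] by simp
    finally show ?thesis by (simp add: S_def sum_distrib_left mult.assoc)
  qed
  define A where "A \<alpha> \<xi> = 1/2 * (S \<alpha> \<xi> + S \<alpha> (- \<xi>))" for \<alpha> \<xi>
  define B where "B \<alpha> \<xi> = 1/2 * (S \<alpha> \<xi> - S \<alpha> (- \<xi>))" for \<alpha> \<xi>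
  have S_refl: "exp_poly L (\<lambda>\<xi>. S \<alpha> (- \<xi>))" for \<alpha>
    by (rule exp_poly_reflect[OF S]) (rule sym)
  have "exp_poly L (A \<alpha>)" "exp_poly L (B \<alpha>)" for \<alpha>
    unfolding A_def B_def by (intro exp_poly_scale exp_poly_add exp_poly_diff S S_refl)+
  moreover have "A \<alpha> (- \<xi>) = A \<alpha> \<xi>" "B \<alpha> (- \<xi>) = - B \<alpha> \<xi>" for \<alpha> \<xi>
    by (simp_all add: A_def B_def field_simps)
  moreover have "f \<xi> = even_tail n A B \<xi>" for \<xi>
  proof -
    have "f \<xi> = 1/2 * (f \<xi> + f (- \<xi>))" by (simp add: even)
    also have "\<dots> = 1/2 * ((\<Sum>\<alpha> | msize \<alpha> = n. S \<alpha> \<xi> * Pi_poly \<alpha> \<xi>)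
        + (\<Sum>\<alpha> | msize \<alpha> = n. S \<alpha> (- \<xi>) * Pi_poly \<alpha> (- \<xi>)))"
      by (simp only: f_eq)
    also have "\<dots> = even_tail n A B \<xi>"
      unfolding sum.distrib [symmetric] sum_distrib_left even_tail_alt
      by (intro sum.cong refl) (simp add: A_def B_def field_simps)
    finally show ?thesis .
  qed
  ultimately show ?thesis
    by (intro exI[of _ A] exI[of _ B]) (auto simp: fun_eq_iff)
qed

section \<open>Components with prescribed moments\<close>

context symmetric_digits
begin

definition self_paired_component where
  "self_paired_component n lam g A B \<eta>
     = (\<Sum>\<beta>\<in>Delta n. lam \<beta> / of_nat m * g \<beta> \<eta>) + even_tail n A B \<eta>"

text \<open>
One component of a pair, multiplied by \<open>wave (M\<^sup>-\<^sup>1 (c - s\<^sub>i))\<close> to make its frequencies integral;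
its moments are therefore the binomial transform of the numbers \<open>lam \<gamma> / m\<close>.
\<close>

definition free_component where
  "free_component n lam i g T \<eta>
     = (\<Sum>\<beta>\<in>Delta n. binomial_transform (shift i) (\<lambda>\<gamma>. lam \<gamma> / of_nat m) \<beta> * g \<beta> \<eta>)
       + (\<Sum>\<alpha> | msize \<alpha> = n. T \<alpha> \<eta> * Pi_poly \<alpha> \<eta>)"

text \<open>
The terms with odd \<open>[\<beta>]\<close> have coefficient zero, so the particular solution built from \<open>g\<close> is even
and has the prescribed moments; the difference to \<open>f\<close> is even and vanishes to order \<open>n\<close>.
\<close>

lemma self_paired_component_iff:
  assumes j: "j \<in> J_set M c s"
    and lam: "\<And>\<beta>. \<beta> \<in> Delta n \<Longrightarrow> odd (msize \<beta>) \<Longrightarrow> lam \<beta> = 0"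
    and g: "\<And>\<beta>. \<beta> \<in> Delta_even n \<Longrightarrow> exp_poly (coset j) (g \<beta>) \<and> g \<beta> \<in> Theta_A \<beta> n"
  shows "exp_poly (coset j) f \<and> (\<forall>\<eta>. f (- \<eta>) = f \<eta>) \<and>
      (\<forall>\<beta> \<in> Delta n. moment \<beta> f = lam \<beta> / of_nat m)
    \<longleftrightarrow> (\<exists>A B. (\<forall>\<alpha>. msize \<alpha> = n \<longrightarrow> exp_poly (coset j) (A \<alpha>) \<and> (\<forall>\<xi>. A \<alpha> (- \<xi>) = A \<alpha> \<xi>) \<and>
          exp_poly (coset j) (B \<alpha>) \<and> (\<forall>\<xi>. B \<alpha> (- \<xi>) = - B \<alpha> \<xi>)) \<and>
        f = self_paired_component n lam g A B)"
    (is "?lhs \<longleftrightarrow> ?rhs")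
proof -
  have jm: "j < m" "mirror j = j" using j by (simp_all add: J_set_def)
  have L: "coset j = (+) (sigma_of M c s j) ` int_lattice"
    by (rule sigma_of_coset[OF det c_half digits j, symmetric])
  have neg: "- a \<in> coset j" if "a \<in> coset j" for a
    using uminus_digit_coset[OF det c_half digits jm(1) that] jm(2) by simp
  define h where "h = (\<lambda>\<eta>. \<Sum>\<beta>\<in>Delta n. lam \<beta> / of_nat m * g \<beta> \<eta>)"
  have comp: "self_paired_component n lam g A B = (\<lambda>\<eta>. h \<eta> + even_tail n A B \<eta>)" for A B
    by (simp add: self_paired_component_def fun_eq_iff h_def)
  have "exp_poly (coset j) h \<and> (\<forall>\<beta>\<in>Delta n. moment \<beta> h = lam \<beta> / of_nat m)"
  proof -
    have S: "Delta_even n \<subseteq> Delta n" by (auto simp: Delta_even_def)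
    have mu: "lam \<beta> / of_nat m = 0" if "\<beta> \<in> Delta n - Delta_even n" for \<beta>
      using that lam by (simp add: Delta_even_def)
    have dual: "moment \<alpha> (g \<beta>) = (if \<alpha> = \<beta> then 1 else 0)"
      if "\<alpha> \<in> Delta n" "\<beta> \<in> Delta_even n" for \<alpha> \<beta>
      using that g by (intro Theta_moment) (auto simp: Theta_A_def)
    show ?thesis
      unfolding h_def using g
      by (intro conjI ballI moment_interpolation[OF S, where L = "coset j"] mu dual) auto
  qed
  then have h: "exp_poly (coset j) h" and mom_h: "\<And>\<beta>. \<beta> \<in> Delta n \<Longrightarrow> moment \<beta> h = lam \<beta> / of_nat m"
    by blast+
  have even_h: "h (- \<eta>) = h \<eta>" for \<eta>
    unfolding h_def
  proof (intro sum.cong refl)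
    fix \<beta> :: "nat ^ 'd" assume \<beta>: "\<beta> \<in> Delta n"
    show "lam \<beta> / of_nat m * g \<beta> (- \<eta>) = lam \<beta> / of_nat m * g \<beta> \<eta>"
      using g[of \<beta>] lam[OF \<beta>] \<beta> by (cases "even (msize \<beta>)") (auto simp: Delta_even_def Theta_A_def)
  qed
  show ?thesis
  proof
    assume lhs: ?lhs
    define r where "r \<eta> = f \<eta> - h \<eta>" for \<eta>
    have "exp_poly (coset j) r" unfolding r_def using lhs h by (blast intro: exp_poly_diff)
    moreover have "r (- \<eta>) = r \<eta>" for \<eta> using lhs by (simp add: r_def even_h)
    moreover have "flat n r"
      unfolding r_def using lhs mom_h by (subst same_moments_iff_flat[symmetric]) (auto intro: h)
    ultimately obtain A B where AB: "\<forall>\<alpha>. exp_poly (coset j) (A \<alpha>) \<and> (\<forall>\<xi>. A \<alpha> (- \<xi>) = A \<alpha> \<xi>) \<and>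
        exp_poly (coset j) (B \<alpha>) \<and> (\<forall>\<xi>. B \<alpha> (- \<xi>) = - B \<alpha> \<xi>)" "r = even_tail n A B"
      using even_flat_imp_even_tail[OF L neg] by blast
    have "f \<eta> = h \<eta> + even_tail n A B \<eta>" for \<eta>
      using r_def[of \<eta>] unfolding AB(2) by simp
    then have f: "f = (\<lambda>\<eta>. h \<eta> + even_tail n A B \<eta>)" by (rule ext)
    show ?rhs
      using AB(1) by (intro exI[of _ A] exI[of _ B] conjI f[folded comp]) blast
  next
    assume ?rhs
    then obtain A B where AB: "\<And>\<alpha>. msize \<alpha> = n \<Longrightarrow> exp_poly (coset j) (A \<alpha>)"
        "\<And>\<alpha> \<xi>. msize \<alpha> = n \<Longrightarrow> A \<alpha> (- \<xi>) = A \<alpha> \<xi>"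
        "\<And>\<alpha>. msize \<alpha> = n \<Longrightarrow> exp_poly (coset j) (B \<alpha>)"
        "\<And>\<alpha> \<xi>. msize \<alpha> = n \<Longrightarrow> B \<alpha> (- \<xi>) = - B \<alpha> \<xi>"
      and f: "f = (\<lambda>\<eta>. h \<eta> + even_tail n A B \<eta>)"
      unfolding comp by blast
    have t: "exp_poly (coset j) (even_tail n A B)" "flat n (even_tail n A B)"
      using exp_poly_even_tail[OF L] flat_even_tail[OF L] AB by blast+
    have f_exp: "exp_poly (coset j) f" unfolding f by (rule exp_poly_add[OF h t(1)])
    have f_even: "f (- \<eta>) = f \<eta>" for \<eta>
      unfolding f even_h using AB by (subst even_tail_uminus) auto
    have f_mom: "moment \<beta> f = lam \<beta> / of_nat m" if "\<beta> \<in> Delta n" for \<beta>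
      using t(2) that by (simp add: f moment_add[OF h t(1)] mom_h flat_def Delta_def)
    show ?lhs using f_exp f_even f_mom by blast
  qed
qed

lemma free_component_iff:
  assumes g: "\<And>\<beta>. \<beta> \<in> Delta n \<Longrightarrow> trig_poly (g \<beta>) \<and> g \<beta> \<in> Theta \<beta> n"
  shows "exp_poly (coset i) f \<and> (\<forall>\<beta> \<in> Delta n. moment \<beta> f = lam \<beta> / of_nat m)
    \<longleftrightarrow> (\<exists>T. (\<forall>\<alpha>. msize \<alpha> = n \<longrightarrow> trig_poly (T \<alpha>)) \<and>
        f = (\<lambda>\<eta>. wave (- shift i) \<eta> * free_component n lam i g T \<eta>))"
    (is "?lhs \<longleftrightarrow> ?rhs")
proof -
  define \<mu> where "\<mu> = binomial_transform (shift i) (\<lambda>\<gamma>. lam \<gamma> / of_nat m)"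
  define h where "h = (\<lambda>\<eta>. \<Sum>\<beta>\<in>Delta n. \<mu> \<beta> * g \<beta> \<eta>)"
  have g': "exp_poly int_lattice (g \<beta>)" if "\<beta> \<in> Delta n" for \<beta>
    using g[OF that] by (simp add: exp_poly_trig_poly)
  have dual: "moment \<alpha> (g \<beta>) = (if \<alpha> = \<beta> then 1 else 0)" if "\<alpha> \<in> Delta n" "\<beta> \<in> Delta n" for \<alpha> \<beta>
    using that g by (intro Theta_moment) auto
  have h: "exp_poly int_lattice h"
    unfolding h_def by (rule moment_interpolation(1)[where S = "Delta n"]) (auto intro: g' simp: dual)
  have mom_h: "moment \<beta> h = \<mu> \<beta>" if "\<beta> \<in> Delta n" for \<beta>
    unfolding h_def
    by (rule moment_interpolation(2)[where S = "Delta n" and L = int_lattice])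
      (auto intro: g' that simp: dual)
  define \<tau> where "\<tau> = (\<lambda>\<eta>. wave (shift i) \<eta> * f \<eta>)"
  have f: "f = (\<lambda>\<eta>. wave (- shift i) \<eta> * \<tau> \<eta>)" by (simp add: \<tau>_def wave_uminus)
  have freq: "exp_poly (coset i) f \<longleftrightarrow> exp_poly int_lattice \<tau>"
  proof
    assume "exp_poly (coset i) f" then show "exp_poly int_lattice \<tau>"
      unfolding \<tau>_def by (rule exp_poly_wave_times) (simp add: mem_digit_coset add.commute)
  next
    assume "exp_poly int_lattice \<tau>" then show "exp_poly (coset i) f"
      unfolding f by (rule exp_poly_wave_times) (simp add: mem_digit_coset)
  qed
  have "?lhs \<longleftrightarrow> exp_poly int_lattice \<tau> \<and> (\<forall>\<beta> \<in> Delta n. moment \<beta> \<tau> = \<mu> \<beta>)"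
  proof (cases "exp_poly (coset i) f")
    case True
    then show ?thesis
      using moments_wave_times_iff[OF True g' dual, of n "shift i" "\<lambda>\<beta>. lam \<beta> / of_nat m"] freq
      by (simp add: \<tau>_def \<mu>_def)
  qed (use freq in blast)
  also have "\<dots> \<longleftrightarrow> exp_poly int_lattice \<tau> \<and> flat n (\<lambda>\<eta>. \<tau> \<eta> - h \<eta>)"
    using same_moments_iff_flat[OF _ h, of int_lattice \<tau> n] mom_h by auto
  also have "\<dots> \<longleftrightarrow> Pi_span n (\<lambda>\<eta>. \<tau> \<eta> - h \<eta>)"
  proof
    assume "exp_poly int_lattice \<tau> \<and> flat n (\<lambda>\<eta>. \<tau> \<eta> - h \<eta>)"
    then show "Pi_span n (\<lambda>\<eta>. \<tau> \<eta> - h \<eta>)"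
      using h by (blast intro: flat_imp_Pi_span exp_poly_diff)
  next
    assume *: "Pi_span n (\<lambda>\<eta>. \<tau> \<eta> - h \<eta>)"
    have "exp_poly int_lattice (\<lambda>\<eta>. (\<tau> \<eta> - h \<eta>) + h \<eta>)"
      by (rule exp_poly_add[OF exp_poly_Pi_span[OF *] h])
    then show "exp_poly int_lattice \<tau> \<and> flat n (\<lambda>\<eta>. \<tau> \<eta> - h \<eta>)"
      using flat_Pi_span[OF *] by simp
  qed
  also have "\<dots> \<longleftrightarrow> (\<exists>T. (\<forall>\<alpha>. msize \<alpha> = n \<longrightarrow> trig_poly (T \<alpha>)) \<and>
      (\<lambda>\<eta>. \<tau> \<eta> - h \<eta>) = (\<lambda>\<eta>. \<Sum>\<alpha> | msize \<alpha> = n. T \<alpha> \<eta> * Pi_poly \<alpha> \<eta>))"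
  proof
    assume "\<exists>T. (\<forall>\<alpha>. msize \<alpha> = n \<longrightarrow> trig_poly (T \<alpha>)) \<and>
      (\<lambda>\<eta>. \<tau> \<eta> - h \<eta>) = (\<lambda>\<eta>. \<Sum>\<alpha> | msize \<alpha> = n. T \<alpha> \<eta> * Pi_poly \<alpha> \<eta>)"
    then show "Pi_span n (\<lambda>\<eta>. \<tau> \<eta> - h \<eta>)"
      by (auto intro!: Pi_span_sum Pi_span_times_Pi_poly simp: exp_poly_trig_poly)
  qed (auto simp: Pi_span_def exp_poly_trig_poly)
  also have "\<dots> \<longleftrightarrow> ?rhs"
  proof -
    have "(\<lambda>\<eta>. \<tau> \<eta> - h \<eta>) = t \<longleftrightarrow> f = (\<lambda>\<eta>. wave (- shift i) \<eta> * (h \<eta> + t \<eta>))" for t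
      by (simp add: f fun_eq_iff diff_eq_eq add.commute)
    then show ?thesis unfolding free_component_def h_def \<mu>_def by simp
  qed
  finally show ?thesis .
qed

text \<open>
The indices split into the self-paired ones, \<open>I1\<close>, and the mirror images of \<open>I1\<close>.
\<close>

lemma polyphase_split:
  assumes I: "I_set M c s = I1 \<union> I2" "I1 \<inter> I2 = {}"
      "\<forall>i \<in> I_set M c s. i \<in> I1 \<longleftrightarrow> mirror i \<in> I2"
    and q: "\<And>i \<eta>. i \<in> I1 \<Longrightarrow> q (mirror i) \<eta> = q i (- \<eta>)"
  shows "polyphase q \<xi> = wave c \<xi> * (\<Sum>j \<in> J_set M c s. q j (mapply (transpose M) \<xi>))
    + (\<Sum>i\<in>I1. wave c \<xi> * q i (mapply (transpose M) \<xi>) + wave c \<xi> * q i (- mapply (transpose M) \<xi>))"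
proof -
  let ?y = "mapply (transpose M) \<xi>"
  have I1: "i < m" "i \<in> I_set M c s" if "i \<in> I1" for i using that I by (auto simp: I_set_def)
  have fin: "finite I1" "finite I2" "finite (J_set M c s)"
    using I(1) finite_subset[of "I_set M c s" "{..<m}"] by (auto simp: I_set_def J_set_def)
  have I2: "I2 = mirror ` I1"
  proof (intro equalityI subsetI)
    fix i assume i: "i \<in> I2"
    then have im: "i < m" "mirror i \<noteq> i" using I(1) by (auto simp: I_set_def)
    have "mirror i \<in> I_set M c s"
      using im mirror_less[of i] mirror_mirror[of i] by (auto simp: I_set_def)
    then have "mirror i \<in> I1"
      using I(3) mirror_mirror[OF im(1)] i by metis
    then show "i \<in> mirror ` I1" using mirror_mirror[OF im(1)] by (metis imageI)
  qed (use I I1 in auto)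
  have "inj_on mirror I1" by (rule inj_on_inverseI[of _ mirror]) (simp add: mirror_mirror I1)
  then have sum_I2: "(\<Sum>i\<in>I2. q i ?y) = (\<Sum>i\<in>I1. q i (- ?y))"
    unfolding I2 by (subst sum.reindex) (auto simp: q)
  have "{..<m} = J_set M c s \<union> (I1 \<union> I2)"
    unfolding I(1)[symmetric] by (auto simp: J_set_def I_set_def)
  moreover have "J_set M c s \<inter> (I1 \<union> I2) = {}"
    unfolding I(1)[symmetric] by (auto simp: J_set_def I_set_def)
  ultimately have "(\<Sum>k<m. q k ?y) = (\<Sum>j \<in> J_set M c s. q j ?y) + ((\<Sum>i\<in>I1. q i ?y) + (\<Sum>i\<in>I1. q i (- ?y)))"
    using fin I(2) by (simp add: sum.union_disjoint sum_I2)
  then show ?thesis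
    by (simp add: polyphase_def sum.distrib sum_distrib_left distrib_left)
qed

text \<open>
Here the frequencies \<open>c\<close> and \<open>M (- M\<^sup>-\<^sup>1 (c - s\<^sub>i))\<close> add up to \<open>s\<^sub>i\<close>, and with the opposite sign to
\<open>2c - s\<^sub>i\<close>: the waves that accompany the two components of a pair.
\<close>

lemma wave_shift:
  "wave c \<xi> * (wave (- shift i) (mapply (transpose M) \<xi>) * z) = wave (of_int_vec (s i)) \<xi> * z"
  "wave c \<xi> * (wave (- shift i) (- mapply (transpose M) \<xi>) * z) = wave (2 *\<^sub>R c - of_int_vec (s i)) \<xi> * z"
proof -
  have "wave (- shift i) (mapply (transpose M) \<xi>) = wave (of_int_vec (s i) - c) \<xi>"
    by (simp add: mapply_uminus mapply_shift flip: wave_mapply)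
  moreover have "wave (- shift i) (- mapply (transpose M) \<xi>) = wave (c - of_int_vec (s i)) \<xi>"
    by (simp add: mapply_shift flip: wave_mapply wave_uminus)
  ultimately show
    "wave c \<xi> * (wave (- shift i) (mapply (transpose M) \<xi>) * z) = wave (of_int_vec (s i)) \<xi> * z"
    "wave c \<xi> * (wave (- shift i) (- mapply (transpose M) \<xi>) * z) = wave (2 *\<^sub>R c - of_int_vec (s i)) \<xi> * z"
    by (simp_all add: scaleR_2 add_diff_eq flip: mult.assoc wave_add)
qed

lemma m0_star_regroup:
  "m0_star M c n s I1 G GA lam \<xi>
    = wave c \<xi> * (\<Sum>j \<in> J_set M c s. \<Sum>\<beta>\<in>Delta n. lam \<beta> / of_nat m * GA \<beta> j (mapply (transpose M) \<xi>))
      + (\<Sum>i\<in>I1.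
          wave (of_int_vec (s i)) \<xi> *
            (\<Sum>\<beta>\<in>Delta n. binomial_transform (shift i) (\<lambda>\<gamma>. lam \<gamma> / of_nat m) \<beta> *
              G \<beta> i (mapply (transpose M) \<xi>))
        + wave (2 *\<^sub>R c - of_int_vec (s i)) \<xi> *
            (\<Sum>\<beta>\<in>Delta n. binomial_transform (shift i) (\<lambda>\<gamma>. lam \<gamma> / of_nat m) \<beta> *
              G \<beta> i (- mapply (transpose M) \<xi>)))"
  unfolding m0_star_def
proof (rule arg_cong2[of _ _ _ _ "(+)"])
  show "1 / of_nat m * (\<Sum>j \<in> J_set M c s. \<Sum>\<beta> \<in> Delta n. lam \<beta> * GA \<beta> j (mapply (transpose M) \<xi>) * wave c \<xi>)
    = wave c \<xi> * (\<Sum>j \<in> J_set M c s. \<Sum>\<beta>\<in>Delta n. lam \<beta> / of_nat m * GA \<beta> j (mapply (transpose M) \<xi>))"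
    unfolding sum_distrib_left by (intro sum.cong refl) simp
next
  have summand: "1 / k * (l * b * p * (x * v + y * w))
      = v * (b * p * (l / k) * x) + w * (b * p * (l / k) * y)"
    for k l b p v w x y :: complex
    by (simp add: divide_inverse algebra_simps)
  show "1 / of_nat m *
       (\<Sum>i \<in> I1. \<Sum>\<beta> \<in> Delta n. \<Sum>\<gamma> \<in> {\<gamma>. \<gamma> \<le> \<beta>}.
          lam \<gamma> * complex_of_real (mbinom \<beta> \<gamma>) * complex_of_real (mpower (shift i) (\<beta> - \<gamma>)) *
          (G \<beta> i (mapply (transpose M) \<xi>) * wave (of_int_vec (s i)) \<xi> +
           G \<beta> i (- mapply (transpose M) \<xi>) * wave (2 *\<^sub>R c - of_int_vec (s i)) \<xi>))
    = (\<Sum>i\<in>I1.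
          wave (of_int_vec (s i)) \<xi> *
            (\<Sum>\<beta>\<in>Delta n. binomial_transform (shift i) (\<lambda>\<gamma>. lam \<gamma> / of_nat m) \<beta> *
              G \<beta> i (mapply (transpose M) \<xi>))
        + wave (2 *\<^sub>R c - of_int_vec (s i)) \<xi> *
            (\<Sum>\<beta>\<in>Delta n. binomial_transform (shift i) (\<lambda>\<gamma>. lam \<gamma> / of_nat m) \<beta> *
              G \<beta> i (- mapply (transpose M) \<xi>)))"
    unfolding binomial_transform_def sum_distrib_left sum_distrib_right sum.distrib [symmetric]
    by (intro sum.cong refl) (simp only: summand of_real_mult)
qed

end

section \<open>The general form of symmetric masks with sum rule\<close>

theorem theorem16:
  fixes M :: "int ^ 'd ^ 'd::finite"
    and c :: "real ^ 'd"
    and n :: nat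
    and s :: "nat \<Rightarrow> int ^ 'd"
    and Dt :: "(int ^ 'd) set"
    and I1 I2 :: "nat set"
    and G GA :: "nat ^ 'd \<Rightarrow> nat \<Rightarrow> real ^ 'd \<Rightarrow> complex"
    and m0 :: "real ^ 'd \<Rightarrow> complex"
  assumes dilation: "matrix_dilation M"
    and c_half: "c \<in> half_lattice"
    and n_pos: "n \<ge> 1"
    and digits: "digit_enum M s"
    and dual_digits: "digit_set (transpose M) Dt" "0 \<in> Dt"
    and digits_paired:
      "\<forall>i \<in> I_set M c s. of_int_vec (s i) + of_int_vec (s (partner M c s i)) = 2 *\<^sub>R c"
    and splitting: "I_set M c s = I1 \<union> I2" "I1 \<inter> I2 = {}"
      "\<forall>i \<in> I_set M c s. i \<in> I1 \<longleftrightarrow> partner M c s i \<in> I2"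
    and G: "\<forall>\<beta> \<in> Delta n. \<forall>i \<in> I1. trig_poly (G \<beta> i) \<and> G \<beta> i \<in> Theta \<beta> n"
    and GA: "\<forall>\<beta> \<in> Delta_even n. \<forall>j \<in> J_set M c s.
      semi_trig_poly (sigma_of M c s j) (GA \<beta> j) \<and> GA \<beta> j \<in> Theta_A \<beta> n"
  shows "mask m0 \<and> symmetric_about c m0 \<and> sum_rule M Dt n m0 \<longleftrightarrow>
    (\<exists>(lam :: nat ^ 'd \<Rightarrow> complex)
      (A :: nat ^ 'd \<Rightarrow> nat \<Rightarrow> real ^ 'd \<Rightarrow> complex)
      (B :: nat ^ 'd \<Rightarrow> nat \<Rightarrow> real ^ 'd \<Rightarrow> complex)
      (T :: nat ^ 'd \<Rightarrow> nat \<Rightarrow> real ^ 'd \<Rightarrow> complex).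
      lam 0 = 1 \<and> (\<forall>\<alpha> \<in> Delta n. odd (msize \<alpha>) \<longrightarrow> lam \<alpha> = 0) \<and>
      (\<forall>\<alpha> j. msize \<alpha> = n \<and> j \<in> J_set M c s \<longrightarrow>
         semi_trig_poly (sigma_of M c s j) (A \<alpha> j) \<and> (\<forall>\<xi>. A \<alpha> j (- \<xi>) = A \<alpha> j \<xi>) \<and>
         semi_trig_poly (sigma_of M c s j) (B \<alpha> j) \<and> (\<forall>\<xi>. B \<alpha> j (- \<xi>) = - B \<alpha> j \<xi>)) \<and>
      (\<forall>\<alpha> i. msize \<alpha> = n \<and> i \<in> I1 \<longrightarrow> trig_poly (T \<alpha> i)) \<and>
      (\<forall>\<xi>. m0 \<xi> =
         m0_star M c n s I1 G GA lam \<xi> +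
         wave c \<xi> *
           (\<Sum>j \<in> J_set M c s. \<Sum>\<alpha> | msize \<alpha> = n.
              A \<alpha> j (mapply (transpose M) \<xi>) *
                complex_of_real (Re (Pi_poly \<alpha> (mapply (transpose M) \<xi>))) +
              \<i> * B \<alpha> j (mapply (transpose M) \<xi>) *
                complex_of_real (Im (Pi_poly \<alpha> (mapply (transpose M) \<xi>)))) +
         (\<Sum>i \<in> I1. \<Sum>\<alpha> | msize \<alpha> = n.
            T \<alpha> i (mapply (transpose M) \<xi>) * Pi_poly \<alpha> (mapply (transpose M) \<xi>) *
              wave (of_int_vec (s i)) \<xi> +
            T \<alpha> i (- mapply (transpose M) \<xi>) * Pi_poly \<alpha> (- mapply (transpose M) \<xi>) *
              wave (2 *\<^sub>R c - of_int_vec (s i)) \<xi>)))"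
proof -
  interpret symmetric_digits M c s Dt
    using matrix_dilation_det_nonzero[OF dilation] c_half digits dual_digits by unfold_locales
  define J where "J = J_set M c s"
  have J: "j < m" "mirror j = j" if "j \<in> J" for j using that by (simp_all add: J_def J_set_def)
  have I1: "i < m" "i \<notin> J" "mirror i \<notin> J" "mirror i \<notin> I1" if "i \<in> I1" for i
  proof -
    have i: "i \<in> I_set M c s" "mirror i \<in> I2" using that splitting by auto
    then show "i < m" "i \<notin> J" "mirror i \<notin> J" "mirror i \<notin> I1"
      using splitting(1,2) by (auto simp: I_set_def J_def J_set_def)
  qed
  have cases: "k \<in> J \<or> k \<in> I1 \<or> (k \<in> I2 \<and> mirror k \<in> I1)" if k: "k < m" for k
  proof (cases "k \<in> I_set M c s")
    case True
    then have "mirror k \<in> I_set M c s"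
      using mirror_less[OF k] mirror_mirror[OF k] by (auto simp: I_set_def)
    then show ?thesis using splitting True mirror_mirror[OF k] by (metis Un_iff)
  qed (use k in \<open>auto simp: I_set_def J_def J_set_def\<close>)
  have coset_J: "semi_trig_poly (sigma_of M c s j) t \<longleftrightarrow> exp_poly (coset j) t" if "j \<in> J" for j t
    using that sigma_of_half[OF det c_half digits] sigma_of_bounds[OF det c_half digits]
      sigma_of_coset[OF det c_half digits]
    by (simp add: exp_poly_semi_trig_poly J_def)

  define cJ where "cJ lam A B j
      = self_paired_component n lam (\<lambda>\<beta>. GA \<beta> j) (\<lambda>\<alpha>. A \<alpha> j) (\<lambda>\<alpha>. B \<alpha> j)" for lam A B j
  define cI where "cI lam T i = free_component n lam i (\<lambda>\<beta>. G \<beta> i) (\<lambda>\<alpha>. T \<alpha> i)" for lam T i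
  let ?N = "mapply (transpose M)"
  define F where "F lam A B T \<xi> = m0_star M c n s I1 G GA lam \<xi> +
         wave c \<xi> *
           (\<Sum>j \<in> J_set M c s. \<Sum>\<alpha> | msize \<alpha> = n.
              A \<alpha> j (?N \<xi>) * complex_of_real (Re (Pi_poly \<alpha> (?N \<xi>))) +
              \<i> * B \<alpha> j (?N \<xi>) * complex_of_real (Im (Pi_poly \<alpha> (?N \<xi>)))) +
         (\<Sum>i \<in> I1. \<Sum>\<alpha> | msize \<alpha> = n.
            T \<alpha> i (?N \<xi>) * Pi_poly \<alpha> (?N \<xi>) * wave (of_int_vec (s i)) \<xi> +
            T \<alpha> i (- ?N \<xi>) * Pi_poly \<alpha> (- ?N \<xi>) * wave (2 *\<^sub>R c - of_int_vec (s i)) \<xi>)"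
    for lam A B T \<xi>
  \<comment> \<open>The formula of the theorem is the polyphase representation with the solved components inserted.\<close>
  have F: "F lam A B T \<xi> = polyphase q \<xi>"
    if qJ: "\<And>j. j \<in> J \<Longrightarrow> q j = cJ lam A B j"
      and qI: "\<And>i. i \<in> I1 \<Longrightarrow> q i = (\<lambda>\<eta>. wave (- shift i) \<eta> * cI lam T i \<eta>)"
      and mir: "\<And>i \<eta>. i \<in> I1 \<Longrightarrow> q (mirror i) \<eta> = q i (- \<eta>)"
    for lam A B T q \<xi>
  proof -
    have "polyphase q \<xi> = wave c \<xi> * (\<Sum>j\<in>J. cJ lam A B j (?N \<xi>))
        + (\<Sum>i\<in>I1. wave (of_int_vec (s i)) \<xi> * cI lam T i (?N \<xi>)
            + wave (2 *\<^sub>R c - of_int_vec (s i)) \<xi> * cI lam T i (- ?N \<xi>))"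
      by (subst polyphase_split[OF splitting])
        (simp_all add: mir J_def [symmetric] qJ qI wave_shift)
    also have "\<dots> = F lam A B T \<xi>"
      by (simp add: F_def m0_star_regroup cJ_def cI_def
          self_paired_component_def free_component_def even_tail_def J_def [symmetric]
          sum.distrib distrib_left sum_distrib_left mult_ac)
    finally show ?thesis ..
  qed

  have "mask m0 \<and> symmetric_about c m0 \<and> sum_rule M Dt n m0 \<longleftrightarrow>
    (\<exists>lam A B T. lam 0 = 1 \<and> (\<forall>\<alpha> \<in> Delta n. odd (msize \<alpha>) \<longrightarrow> lam \<alpha> = 0) \<and>
      (\<forall>\<alpha> j. msize \<alpha> = n \<and> j \<in> J_set M c s \<longrightarrow>
         semi_trig_poly (sigma_of M c s j) (A \<alpha> j) \<and> (\<forall>\<xi>. A \<alpha> j (- \<xi>) = A \<alpha> j \<xi>) \<and>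
         semi_trig_poly (sigma_of M c s j) (B \<alpha> j) \<and> (\<forall>\<xi>. B \<alpha> j (- \<xi>) = - B \<alpha> j \<xi>)) \<and>
      (\<forall>\<alpha> i. msize \<alpha> = n \<and> i \<in> I1 \<longrightarrow> trig_poly (T \<alpha> i)) \<and>
      (\<forall>\<xi>. m0 \<xi> = F lam A B T \<xi>))" (is "?lhs \<longleftrightarrow> ?rhs")
  proof
    assume ?lhs
    then obtain q lam where lam: "lam 0 = 1" "\<And>\<beta>. \<beta> \<in> Delta n \<Longrightarrow> odd (msize \<beta>) \<Longrightarrow> lam \<beta> = 0"
      and q: "\<And>k. k < m \<Longrightarrow> exp_poly (coset k) (q k)"
      and mir: "\<And>k \<eta>. k < m \<Longrightarrow> q (mirror k) \<eta> = q k (- \<eta>)"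
      and mom: "\<And>k \<beta>. k < m \<Longrightarrow> \<beta> \<in> Delta n \<Longrightarrow> moment \<beta> (q k) = lam \<beta> / of_nat m"
      and m0: "m0 = polyphase q"
      unfolding mask_iff_polyphase[OF n_pos] by blast
    let ?P = "\<lambda>j A B. (\<forall>\<alpha>. msize \<alpha> = n \<longrightarrow> exp_poly (coset j) (A \<alpha>) \<and> (\<forall>\<xi>. A \<alpha> (- \<xi>) = A \<alpha> \<xi>) \<and>
          exp_poly (coset j) (B \<alpha>) \<and> (\<forall>\<xi>. B \<alpha> (- \<xi>) = - B \<alpha> \<xi>)) \<and>
        q j = self_paired_component n lam (\<lambda>\<beta>. GA \<beta> j) A B"
    have "\<exists>A B. ?P j A B" if j: "j \<in> J" for j
    proof (rule iffD1[OF self_paired_component_iff])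
      have "q j (- \<eta>) = q j \<eta>" for \<eta> using mir[of j \<eta>] J[OF j] by simp
      then show "exp_poly (coset j) (q j) \<and> (\<forall>\<eta>. q j (- \<eta>) = q j \<eta>) \<and>
          (\<forall>\<beta>\<in>Delta n. moment \<beta> (q j) = lam \<beta> / of_nat m)"
        using q mom J(1)[OF j] by blast
      show "exp_poly (coset j) (GA \<beta> j) \<and> GA \<beta> j \<in> Theta_A \<beta> n" if "\<beta> \<in> Delta_even n" for \<beta>
        using GA that j coset_J[OF j] unfolding J_def by blast
    qed (use j lam(2) in \<open>auto simp: J_def\<close>)
    then have "\<forall>j. \<exists>A B. j \<in> J \<longrightarrow> ?P j A B" by blast
    from choice[OF this] obtain A where "\<forall>j. \<exists>B. j \<in> J \<longrightarrow> ?P j (A j) B" by blast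
    from choice[OF this] obtain B where AB: "\<And>j. j \<in> J \<Longrightarrow> ?P j (A j) (B j)" by blast
    let ?Q = "\<lambda>i T. (\<forall>\<alpha>. msize \<alpha> = n \<longrightarrow> trig_poly (T \<alpha>)) \<and>
        q i = (\<lambda>\<eta>. wave (- shift i) \<eta> * free_component n lam i (\<lambda>\<beta>. G \<beta> i) T \<eta>)"
    have "\<exists>T. ?Q i T" if i: "i \<in> I1" for i
    proof (rule iffD1[OF free_component_iff])
      show "exp_poly (coset i) (q i) \<and> (\<forall>\<beta>\<in>Delta n. moment \<beta> (q i) = lam \<beta> / of_nat m)"
        using q mom I1(1)[OF i] by blast
    qed (use G i in blast)
    then have "\<forall>i. \<exists>T. i \<in> I1 \<longrightarrow> ?Q i T" by blast
    from choice[OF this] obtain T where T: "\<And>i. i \<in> I1 \<Longrightarrow> ?Q i (T i)" by blast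
    have "m0 \<xi> = F lam (\<lambda>\<alpha> j. A j \<alpha>) (\<lambda>\<alpha> j. B j \<alpha>) (\<lambda>\<alpha> i. T i \<alpha>) \<xi>" for \<xi>
      unfolding m0
    proof (rule F[symmetric])
      show "q j = cJ lam (\<lambda>\<alpha> j. A j \<alpha>) (\<lambda>\<alpha> j. B j \<alpha>) j" if "j \<in> J" for j
        using AB[OF that] by (simp add: cJ_def fun_eq_iff)
      show "q i = (\<lambda>\<eta>. wave (- shift i) \<eta> * cI lam (\<lambda>\<alpha> i. T i \<alpha>) i \<eta>)" if "i \<in> I1" for i
        using T[OF that] by (simp add: cI_def fun_eq_iff)
    qed (use mir I1 in blast)
    then show ?rhs
      using lam AB T coset_J
      by (intro exI[of _ lam] exI[of _ "\<lambda>\<alpha> j. A j \<alpha>"] exI[of _ "\<lambda>\<alpha> j. B j \<alpha>"]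
          exI[of _ "\<lambda>\<alpha> i. T i \<alpha>"]) (simp add: J_def)
  next
    assume ?rhs
    then obtain lam A B T where lam: "lam 0 = 1" "\<And>\<beta>. \<beta> \<in> Delta n \<Longrightarrow> odd (msize \<beta>) \<Longrightarrow> lam \<beta> = 0"
      and AB': "\<forall>\<alpha> j. msize \<alpha> = n \<and> j \<in> J_set M c s \<longrightarrow>
         semi_trig_poly (sigma_of M c s j) (A \<alpha> j) \<and> (\<forall>\<xi>. A \<alpha> j (- \<xi>) = A \<alpha> j \<xi>) \<and>
         semi_trig_poly (sigma_of M c s j) (B \<alpha> j) \<and> (\<forall>\<xi>. B \<alpha> j (- \<xi>) = - B \<alpha> j \<xi>)"
      and T: "\<And>\<alpha> i. msize \<alpha> = n \<Longrightarrow> i \<in> I1 \<Longrightarrow> trig_poly (T \<alpha> i)"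
      and m0: "\<And>\<xi>. m0 \<xi> = F lam A B T \<xi>"
      by blast
    have AB: "exp_poly (coset j) (A \<alpha> j) \<and> (\<forall>\<xi>. A \<alpha> j (- \<xi>) = A \<alpha> j \<xi>) \<and>
         exp_poly (coset j) (B \<alpha> j) \<and> (\<forall>\<xi>. B \<alpha> j (- \<xi>) = - B \<alpha> j \<xi>)"
      if "msize \<alpha> = n" "j \<in> J" for \<alpha> j
      using AB'[unfolded J_def[symmetric], rule_format, OF conjI[OF that]]
      unfolding coset_J[OF that(2)] .
    \<comment> \<open>Components are read off the formula; those in \<open>I2\<close> are the reflections of their partners in \<open>I1\<close>.\<close>
    define r where "r i \<eta> = wave (- shift i) \<eta> * cI lam T i \<eta>" for i \<eta>
    define q where "q k \<eta> = (if k \<in> J then cJ lam A B k \<eta> else if k \<in> I1 then r k \<eta> else r (mirror k) (- \<eta>))"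
      for k \<eta>
    have qJ: "q j = cJ lam A B j" if "j \<in> J" for j using that by (simp add: q_def fun_eq_iff)
    have qI1: "q i = r i" if "i \<in> I1" for i using that I1 by (simp add: q_def fun_eq_iff)
    have qI2: "q (mirror i) = (\<lambda>\<eta>. r i (- \<eta>))" if "i \<in> I1" for i
      using I1[OF that] mirror_mirror[of i] by (simp add: q_def fun_eq_iff)
    have J_props: "exp_poly (coset j) (q j) \<and> (\<forall>\<eta>. q j (- \<eta>) = q j \<eta>) \<and>
        (\<forall>\<beta>\<in>Delta n. moment \<beta> (q j) = lam \<beta> / of_nat m)" if j: "j \<in> J" for j
    proof (rule iffD2[OF self_paired_component_iff])
      show "exp_poly (coset j) (GA \<beta> j) \<and> GA \<beta> j \<in> Theta_A \<beta> n" if "\<beta> \<in> Delta_even n" for \<beta>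
        using GA that j coset_J[OF j] unfolding J_def by blast
      show "\<exists>A B. (\<forall>\<alpha>. msize \<alpha> = n \<longrightarrow> exp_poly (coset j) (A \<alpha>) \<and> (\<forall>\<xi>. A \<alpha> (- \<xi>) = A \<alpha> \<xi>) \<and>
            exp_poly (coset j) (B \<alpha>) \<and> (\<forall>\<xi>. B \<alpha> (- \<xi>) = - B \<alpha> \<xi>)) \<and>
          q j = self_paired_component n lam (\<lambda>\<beta>. GA \<beta> j) A B"
        using AB[OF _ j]
        by (intro exI[of _ "\<lambda>\<alpha>. A \<alpha> j"] exI[of _ "\<lambda>\<alpha>. B \<alpha> j"]) (simp add: qJ[OF j] cJ_def fun_eq_iff)
    qed (use j lam(2) in \<open>auto simp: J_def\<close>)
    have I_props: "exp_poly (coset i) (r i) \<and> (\<forall>\<beta>\<in>Delta n. moment \<beta> (r i) = lam \<beta> / of_nat m)"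
      if i: "i \<in> I1" for i
    proof (rule iffD2[OF free_component_iff])
      show "\<exists>T. (\<forall>\<alpha>. msize \<alpha> = n \<longrightarrow> trig_poly (T \<alpha>)) \<and>
        r i = (\<lambda>\<eta>. wave (- shift i) \<eta> * free_component n lam i (\<lambda>\<beta>. G \<beta> i) T \<eta>)"
        using T[OF _ i] by (intro exI[of _ "\<lambda>\<alpha>. T \<alpha> i"]) (simp add: r_def cI_def fun_eq_iff)
    qed (use G i in blast)
    have "exp_poly (coset k) (q k) \<and> (\<forall>\<eta>. q (mirror k) \<eta> = q k (- \<eta>)) \<and>
        (\<forall>\<beta>\<in>Delta n. moment \<beta> (q k) = lam \<beta> / of_nat m)" if k: "k < m" for k
      using cases[OF k]
    proof (elim disjE conjE)
      assume "k \<in> J" then show ?thesis using J_props[of k] J[of k] by simp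
    next
      assume "k \<in> I1" then show ?thesis using I_props[of k] by (simp add: qI1 qI2)
    next
      assume k': "mirror k \<in> I1"
      have q: "q k = (\<lambda>\<eta>. r (mirror k) (- \<eta>))" using qI2[OF k'] by (simp add: mirror_mirror[OF k])
      have r: "exp_poly (coset (mirror k)) (r (mirror k))"
        "\<And>\<beta>. \<beta> \<in> Delta n \<Longrightarrow> moment \<beta> (r (mirror k)) = lam \<beta> / of_nat m"
        using I_props[OF k'] by blast+
      have "exp_poly (coset k) (q k)"
        using exp_poly_coset_reflect[OF mirror_less[OF k] r(1)] by (simp add: q mirror_mirror[OF k])
      moreover have "moment \<beta> (q k) = lam \<beta> / of_nat m" if \<beta>: "\<beta> \<in> Delta n" for \<beta>
        using lam(2)[OF \<beta>] by (cases "even (msize \<beta>)") (simp_all add: q moment_reflect[OF r(1)] r(2)[OF \<beta>])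
      moreover have "q (mirror k) \<eta> = q k (- \<eta>)" for \<eta> by (simp add: q qI1[OF k'])
      ultimately show ?thesis by blast
    qed
    moreover have "m0 = polyphase q"
    proof
      fix \<xi> show "m0 \<xi> = polyphase q \<xi>"
        unfolding m0 by (rule F) (simp_all add: qJ qI1 qI2 r_def[abs_def])
    qed
    ultimately show ?lhs
      unfolding mask_iff_polyphase[OF n_pos] using lam by blast
  qed
  then show ?thesis unfolding F_def .
qed

end
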